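(* The mixed-boundary Crouzeix--Raviart space satisfies $$\nabla\cdot\vec V^h=Q^h,$$ where $\nabla\cdot$ is the elementwise divergence; that is, the set of elementwise divergences of fields in $\vec V^h$ is exactly the space of elementwise constant functions.
   Context: Let $n\in\{2,3\}$, let $\Omega\subset\mathbb R^n$ be a bounded connected polygonal/polyhedral Lipschitz domain with outward unit normal $\boldsymbol n$, and let $\partial\Omega$ be split into disjoint relatively open parts $\Gamma^{\mathrm D},\Gamma^{\mathrm N},\Gamma^{\mathrm S},\Gamma^{\mathrm E}$ (closures covering $\partial\Omega$; $|\Gamma^{\mathrm D}|>0$). $\mathcal T^h$ is a conforming simplicial mesh of $\Omega$ that resolves the boundary partition (each boundary face lies in one part), and $\Gamma^{\mathrm N}\cup\Gamma^{\mathrm E}$ contains at least one complete boundary face. $[\![\cdot]\!]$ is the jump across an interior face, $\boldsymbol I$ the identity. $\vec V^h$ is the set of $\boldsymbol v\in[L_2(\Omega)]^n$ with $\boldsymbol v|_T\in[\mathbb P_1(T)]^n$ for all $T\in\mathcal T^h$; $\int_F[\![\boldsymbol v]\!]=\boldsymbol 0$ for all interior faces $F$; $\int_F\boldsymbol v=\boldsymbol 0$ for $F\subset\Gamma^{\mathrm D}$; $\int_F\boldsymbol v\cdot\boldsymbol n=0$ for $F\subset\Gamma^{\mathrm S}$; $\int_F(\boldsymbol I-\boldsymbol n\otimes\boldsymbol n)\boldsymbol v=\boldsymbol 0$ for $F\subset\Gamma^{\mathrm E}$. $Q^h=\{q\in L_2(\Omega):q|_T\in\mathbb P_0(T)\ \forall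 T\in\mathcal T^h\}$. *)

theory Defs
  imports "HOL-Analysis.Analysis"
begin

section \<open>Polyhedral Lipschitz domains\<close>

text \<open>
  Near every boundary point the set is the strict subgraph of a Lipschitz function over the
  hyperplane orthogonal to some unit vector \<open>e\<close>.
\<close>

definition lipschitz_boundary :: "'a::euclidean_space set \<Rightarrow> bool" where
  "lipschitz_boundary \<Omega> \<longleftrightarrow>
     (\<forall>x\<in>frontier \<Omega>. \<exists>U e L \<phi>. open U \<and> x \<in> U \<and> norm e = 1 \<and>
        L-lipschitz_on {y. y \<bullet> e = 0} \<phi> \<and>
        \<Omega> \<inter> U = {y \<in> U. y \<bullet> e < \<phi> (y - (y \<bullet> e) *\<^sub>R e)})"

definition polyhedral_lipschitz_domain :: "'a::euclidean_space set \<Rightarrow> bool" where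
  "polyhedral_lipschitz_domain \<Omega> \<longleftrightarrow>
     open \<Omega> \<and> \<Omega> \<noteq> {} \<and> connected \<Omega> \<and> bounded \<Omega> \<and>
     (\<exists>\<P>. finite \<P> \<and> (\<forall>P\<in>\<P>. polytope P) \<and> closure \<Omega> = \<Union>\<P>) \<and>
     lipschitz_boundary \<Omega>"

section \<open>Meshes and faces\<close>

definition simplicial_mesh :: "(real^'n) set \<Rightarrow> (real^'n) set set \<Rightarrow> bool" where
  "simplicial_mesh \<Omega> \<T> \<longleftrightarrow>
     triangulation \<T> \<and> (\<forall>K\<in>\<T>. int CARD('n) simplex K) \<and> \<Union>\<T> = closure \<Omega>"

definition boundary_faces :: "'a::euclidean_space set \<Rightarrow> 'a set set \<Rightarrow> 'a set set" where
  "boundary_faces \<Omega> \<T> = {F. (\<exists>K\<in>\<T>. F facet_of K) \<and> F \<subseteq> frontier \<Omega>}"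

text \<open>
  Surface measure on a flat face of codimension one: by Fubini, the Lebesgue measure of the
  prism of height one (one half to either side of the hyperplane), projected orthogonally
  onto the face.
\<close>

definition face_measure :: "'a::euclidean_space set \<Rightarrow> 'a measure" where
  "face_measure F =
     distr
       (restrict_space lborel
          {x. closest_point (affine hull F) x \<in> F \<and> infdist x (affine hull F) \<le> 1/2})
       borel (closest_point (affine hull F))"

abbreviation face_integral ::
    "'a::euclidean_space set \<Rightarrow> ('a \<Rightarrow> 'b::{banach,second_countable_topology}) \<Rightarrow> 'b" where
  "face_integral F g \<equiv> integral\<^sup>L (face_measure F) g"

definition boundary_area ::
    "'a::euclidean_space set \<Rightarrow> 'a set set \<Rightarrow> 'a set \<Rightarrow> ennreal" where
  "boundary_area \<Omega> \<T> A = (\<Sum>F\<in>boundary_faces \<Omega> \<T>. emeasure (face_measure F) A)"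

text \<open>
  The outward unit normal of \<open>\<Omega>\<close>, constant on each boundary face: around every relatively
  interior point of the face, \<open>\<Omega>\<close> is the open half-space on the side opposite to the normal.
\<close>

definition outward_normal :: "'a::euclidean_space set \<Rightarrow> 'a set \<Rightarrow> 'a" where
  "outward_normal \<Omega> F =
     (THE \<nu>. norm \<nu> = 1 \<and>
        (\<forall>x\<in>rel_interior F. \<exists>r>0. \<Omega> \<inter> ball x r = {y \<in> ball x r. \<nu> \<bullet> (y - x) < 0}))"

text \<open>
  A closed boundary face may touch the relative boundary of the part it belongs to, so a face
  lies in a part if its relative interior does.
\<close>

definition face_in :: "'a::euclidean_space set \<Rightarrow> 'a set \<Rightarrow> bool" where
  "face_in F \<Gamma> \<longleftrightarrow> rel_interior F \<subseteq> \<Gamma>"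

definition boundary_partition ::
    "'a::euclidean_space set \<Rightarrow> 'a set \<Rightarrow> 'a set \<Rightarrow> 'a set \<Rightarrow> 'a set \<Rightarrow> bool" where
  "boundary_partition \<Omega> \<Gamma>D \<Gamma>N \<Gamma>S \<Gamma>E \<longleftrightarrow>
     (\<forall>\<Gamma>\<in>{\<Gamma>D, \<Gamma>N, \<Gamma>S, \<Gamma>E}. openin (top_of_set (frontier \<Omega>)) \<Gamma>) \<and>
     \<Gamma>D \<inter> \<Gamma>N = {} \<and> \<Gamma>D \<inter> \<Gamma>S = {} \<and> \<Gamma>D \<inter> \<Gamma>E = {} \<and>
     \<Gamma>N \<inter> \<Gamma>S = {} \<and> \<Gamma>N \<inter> \<Gamma>E = {} \<and> \<Gamma>S \<inter> \<Gamma>E = {} \<and>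
     closure \<Gamma>D \<union> closure \<Gamma>N \<union> closure \<Gamma>S \<union> closure \<Gamma>E = frontier \<Omega>"

definition resolves_partition ::
    "'a::euclidean_space set \<Rightarrow> 'a set set \<Rightarrow> 'a set \<Rightarrow> 'a set \<Rightarrow> 'a set \<Rightarrow> 'a set \<Rightarrow> bool" where
  "resolves_partition \<Omega> \<T> \<Gamma>D \<Gamma>N \<Gamma>S \<Gamma>E \<longleftrightarrow>
     (\<forall>F\<in>boundary_faces \<Omega> \<T>. \<exists>\<Gamma>\<in>{\<Gamma>D, \<Gamma>N, \<Gamma>S, \<Gamma>E}. face_in F \<Gamma>)"

section \<open>Piecewise polynomial functions\<close>

text \<open>
  Elements of \<open>L\<^sub>2(\<Omega>)\<close> are handled through representatives on the whole space, whose values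
  outside \<open>\<Omega>\<close> are irrelevant; \<open>L2_class\<close> passes to the equivalence class.
\<close>

definition L2_on ::
    "'a::euclidean_space set \<Rightarrow> ('a \<Rightarrow> 'b::euclidean_space) \<Rightarrow> bool" where
  "L2_on \<Omega> f \<longleftrightarrow>
     set_borel_measurable lebesgue \<Omega> f \<and> set_integrable lebesgue \<Omega> (\<lambda>x. (norm (f x))\<^sup>2)"

definition L2_class ::
    "'a::euclidean_space set \<Rightarrow> ('a \<Rightarrow> 'b::euclidean_space) \<Rightarrow> ('a \<Rightarrow> 'b) set" where
  "L2_class \<Omega> f = {g. AE x\<in>\<Omega> in lebesgue. g x = f x}"

definition P1 :: "('a::real_vector \<Rightarrow> 'b::real_vector) \<Rightarrow> bool" where
  "P1 p \<longleftrightarrow> (\<exists>l b. linear l \<and> p = (\<lambda>x. l x + b))"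

definition P1_on ::
    "'a::euclidean_space set \<Rightarrow> ('a \<Rightarrow> 'b::euclidean_space) \<Rightarrow> ('a \<Rightarrow> 'b) \<Rightarrow> bool" where
  "P1_on K v p \<longleftrightarrow> P1 p \<and> (AE x\<in>K in lebesgue. v x = p x)"

text \<open>
  The polynomial representing \<open>v\<close> on \<open>K\<close>; it provides the trace of \<open>v\<close> from \<open>K\<close> on the faces
  of \<open>K\<close>, which the values of \<open>v\<close> almost everywhere do not give directly.
\<close>

definition local_poly ::
    "('a::euclidean_space \<Rightarrow> 'b::euclidean_space) \<Rightarrow> 'a set \<Rightarrow> 'a \<Rightarrow> 'b" where
  "local_poly v K = (THE p. P1_on K v p)"

definition divergence :: "(real^'n \<Rightarrow> real^'n) \<Rightarrow> real^'n \<Rightarrow> real" where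
  "divergence f x = trace (jacobian f (at x))"

text \<open>
  Element interiors are disjoint, so at most one summand is present; on the skeleton of the mesh,
  a null set, the value is 0.
\<close>

definition broken_div :: "(real^'n) set set \<Rightarrow> (real^'n \<Rightarrow> real^'n) \<Rightarrow> real^'n \<Rightarrow> real" where
  "broken_div \<T> v x = (\<Sum>K | K \<in> \<T> \<and> x \<in> interior K. divergence (local_poly v K) x)"

definition piecewise_constants :: "(real^'n) set \<Rightarrow> (real^'n) set set \<Rightarrow> (real^'n \<Rightarrow> real) set" where
  "piecewise_constants \<Omega> \<T> =
     {q. L2_on \<Omega> q \<and> (\<forall>K\<in>\<T>. \<exists>c. AE x\<in>K in lebesgue. q x = c)}"

text \<open>
  There is no condition on \<open>\<Gamma>\<^sup>N\<close>. For the parts S and E the integrands are \<open>v \<cdot> n\<close> and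
  \<open>(I - n \<otimes> n) v = v - (v \<cdot> n) n\<close>.
\<close>

definition CR_space ::
    "(real^'n) set \<Rightarrow> (real^'n) set set \<Rightarrow> (real^'n) set \<Rightarrow> (real^'n) set \<Rightarrow> (real^'n) set \<Rightarrow>
     (real^'n \<Rightarrow> real^'n) set" where
  "CR_space \<Omega> \<T> \<Gamma>D \<Gamma>S \<Gamma>E =
     {v. L2_on \<Omega> v \<and> (\<forall>K\<in>\<T>. \<exists>p. P1_on K v p) \<and>
       (\<forall>K\<in>\<T>. \<forall>K'\<in>\<T>. \<forall>F. K \<noteq> K' \<and> F facet_of K \<and> F facet_of K' \<longrightarrow>
          face_integral F (\<lambda>x. local_poly v K x - local_poly v K' x) = 0) \<and>
       (\<forall>K\<in>\<T>. \<forall>F\<in>boundary_faces \<Omega> \<T>. F facet_of K \<longrightarrow>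
          (face_in F \<Gamma>D \<longrightarrow> face_integral F (local_poly v K) = 0) \<and>
          (face_in F \<Gamma>S \<longrightarrow>
             face_integral F (\<lambda>x. local_poly v K x \<bullet> outward_normal \<Omega> F) = 0) \<and>
          (face_in F \<Gamma>E \<longrightarrow>
             face_integral F
               (\<lambda>x. local_poly v K x -
                    (local_poly v K x \<bullet> outward_normal \<Omega> F) *\<^sub>R outward_normal \<Omega> F) = 0))}"

end

theory Submission
  imports Defs
begin

text \<open>
  The integral of an affine field over a facet is the area times the value at the centroid, so
  the constraints on a field of the Crouzeix--Raviart space only concern the values of its affine
  pieces at facet centroids. For a facet \<open>F\<close> of a cell with barycentric coordinate \<open>\<beta>\<close> vanishing on
  \<open>F\<close>, the function \<open>1 - n \<beta>\<close> is 1 on \<open>F\<close> and vanishes at the centroids of the other facets. Its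
  multiples by a vector transversal to \<open>F\<close>, on the one or two cells that contain \<open>F\<close>, have nonzero
  constant divergence on exactly these cells. A boundary facet in the Neumann part or in the part
  with free normal component (here the vector is the unit normal) thus yields the indicator function
  of one cell, and interior facets transport indicator functions to neighbouring cells. Every cell is
  reached because the dual graph of the mesh of a connected domain is connected.
\<close>

text \<open>A boundary facet outside \<open>\<Gamma>D\<close> and \<open>\<Gamma>S\<close> removes a
  compatibility condition: if all of them lay in these parts, the divergence theorem on each cell
  would force the elementwise divergence to have integral zero, since all facet fluxes would cancel
  or vanish. The unit normal is chosen at such a facet because it has no tangential part, so one
  field suits both \<open>\<Gamma>N\<close> and \<open>\<Gamma>E\<close>. The factor n is the
  reciprocal of the value of \<beta> at the centroid of another facet: \<beta> is 1 at one of its n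
  vertices and 0 at the rest. A bump on two cells has divergence on both; subtracting a multiple of
  the field already found for the first cell leaves the second alone. Two obstacles come from the
  encoding. Surface integrals are volume integrals over prisms, so the centroid rule is derived from
  a symmetry of the prism. The normal is fixed by the shape of \<Omega> near the face, whereas the
  cells only describe the closure of \<Omega>; the Lipschitz graphs show that \<Omega> is the
  interior of its closure.\<close>

section \<open>Affine functions and face integrals\<close>

text \<open>Pushing Lebesgue measure forward along an affine bijection gives a translation invariant
  measure, hence a constant multiple \<open>k\<close> of Lebesgue measure. For an involution
  \<open>k * k = 1\<close>, and a nonnegative \<open>k\<close> is then 1.\<close>

lemma lborel_distr_affine_involution:
  fixes T :: "'a::euclidean_space \<Rightarrow> 'a"
  assumes "P1 T" and inv: "\<And>x. T (T x) = x"
  shows "distr lborel borel T = lborel"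
proof -
  obtain l d where l: "linear l" and T: "T = (\<lambda>x. l x + d)"
    using assms(1) by (auto simp: P1_def)
  have "continuous_on UNIV T"
    unfolding T using l by (intro continuous_intros linear_continuous_on linear_conv_bounded_linear[THEN iffD1])
  then have mT [measurable]: "T \<in> borel_measurable borel"
    by (rule borel_measurable_continuous_onI)
  \<comment> \<open>The linear part of an affine involution is an involution too, so a shift of the
    argument by \<open>l y\<close> shifts the value by \<open>y\<close>.\<close>
  have shift: "T (l y + x) = y + T x" for x y
  proof -
    have "T (y + T x) = l y + T (T x)"
      by (simp add: T linear_add[OF l])
    then have "T (T (y + T x)) = T (l y + x)"
      by (simp add: inv)
    then show ?thesis by (simp add: inv)
  qed
  have translate: "(\<integral>\<^sup>+x. f (a + x) \<partial>lborel) = (\<integral>\<^sup>+x. f x \<partial>lborel)"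
    if [measurable]: "f \<in> borel_measurable borel" for f :: "'a \<Rightarrow> ennreal" and a
  proof -
    have "lborel = distr lborel borel ((+) a)"
      using lborel_affine[of 1 a] by (simp add: density_1)
    then have "(\<integral>\<^sup>+x. f x \<partial>lborel) = (\<integral>\<^sup>+x. f x \<partial>distr lborel borel ((+) a))"
      by simp
    also have "\<dots> = (\<integral>\<^sup>+x. f (a + x) \<partial>lborel)"
      by (subst nn_integral_distr) auto
    finally show ?thesis by simp
  qed
  \<comment> \<open>The unit box is a test set of mass one: inserting its indicator as a factor and
    exchanging the integrals separates \<open>A\<close> from \<open>T\<close>.\<close>
  define Q :: "'a set" where "Q = box 0 One"
  define k where "k = (\<integral>\<^sup>+x. indicator Q (- T x) \<partial>lborel)"
  have [measurable]: "Q \<in> sets borel" by (simp add: Q_def)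
  have Q1: "emeasure lborel Q = 1"
    by (simp add: Q_def emeasure_lborel_box_eq)
  have scale: "emeasure lborel (T -` A) = k * emeasure lborel A"
    if [measurable]: "A \<in> sets borel" for A
  proof -
    have mQ: "(\<integral>\<^sup>+y. indicator Q (y - T x) \<partial>lborel) = 1" for x
      using translate[of "indicator Q" "- T x"] Q1 by simp
    have "emeasure lborel (T -` A) = (\<integral>\<^sup>+x. indicator A (T x) \<partial>lborel)"
      using measurable_sets[OF mT that]
      by (simp add: nn_integral_indicator[symmetric] indicator_vimage[symmetric] o_def
          del: nn_integral_indicator)
    also have "\<dots> = (\<integral>\<^sup>+x. \<integral>\<^sup>+y. indicator A (T x) * indicator Q (y - T x) \<partial>lborel \<partial>lborel)"
      by (simp add: nn_integral_cmult mQ)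
    also have "\<dots> = (\<integral>\<^sup>+y. \<integral>\<^sup>+x. indicator A (T x) * indicator Q (y - T x) \<partial>lborel \<partial>lborel)"
      by (rule lborel_pair.Fubini'[symmetric]) measurable
    also have "\<dots> = (\<integral>\<^sup>+y. \<integral>\<^sup>+x. indicator A (y + T x) * indicator Q (- T x) \<partial>lborel \<partial>lborel)"
    proof (rule nn_integral_cong)
      fix y
      show "(\<integral>\<^sup>+x. indicator A (T x) * indicator Q (y - T x) \<partial>lborel)
          = (\<integral>\<^sup>+x. indicator A (y + T x) * indicator Q (- T x) \<partial>lborel)"
        using translate[of "\<lambda>x. indicator A (T x) * indicator Q (y - T x)" "l y"] by (simp add: shift)
    qed
    also have "\<dots> = (\<integral>\<^sup>+x. \<integral>\<^sup>+y. indicator A (y + T x) * indicator Q (- T x) \<partial>lborel \<partial>lborel)"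
      by (rule lborel_pair.Fubini') measurable
    also have "\<dots> = (\<integral>\<^sup>+x. emeasure lborel A * indicator Q (- T x) \<partial>lborel)"
    proof (rule nn_integral_cong)
      fix x
      show "(\<integral>\<^sup>+y. indicator A (y + T x) * indicator Q (- T x) \<partial>lborel)
          = emeasure lborel A * indicator Q (- T x)"
        using translate[of "indicator A" "T x"] by (simp add: nn_integral_multc add.commute)
    qed
    also have "\<dots> = k * emeasure lborel A"
      by (simp add: nn_integral_cmult k_def mult.commute)
    finally show ?thesis .
  qed
  \<comment> \<open>Two preimages multiply the measure of \<open>Q\<close> by the factor twice, yet
    return to \<open>Q\<close>.\<close>
  have inv': "T -` (T -` A) = A" for A
    by (auto simp: inv)
  have "1 = k * k"
    using scale[of Q] scale[of "T -` Q"] measurable_sets[OF mT, of Q] by (simp add: inv' Q1)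
  then have "k = 1"
  proof (cases k)
    case (real r)
    have "ennreal (r * r) = ennreal 1"
      using \<open>1 = k * k\<close> real by (simp add: ennreal_mult)
    then have "r * r = 1"
      using real by (subst (asm) ennreal_inj) auto
    then show ?thesis
      using real by (auto simp: square_eq_1_iff)
  next
    case top
    then show ?thesis using \<open>1 = k * k\<close> by (simp add: ennreal_top_mult)
  qed
  then show ?thesis
    using mT by (intro measure_eqI) (auto simp: emeasure_distr scale)
qed

section \<open>Affine functions and barycentric coordinates\<close>

lemma P1_inner: "P1 (\<lambda>x. (g \<bullet> x + c) :: real)"
  unfolding P1_def by (intro exI[of _ "\<lambda>x. g \<bullet> x"] exI[of _ c]) (auto intro: bounded_linear.linear bounded_linear_inner_right)

lemma P1_continuous_on:
  fixes f :: "'a::euclidean_space \<Rightarrow> 'b::real_normed_vector"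
  assumes "P1 f"
  shows "continuous_on S f"
proof -
  obtain l d where "linear l" "f = (\<lambda>x. l x + d)"
    using assms by (auto simp: P1_def)
  then show ?thesis
    by (simp add: continuous_on_add linear_continuous_on linear_conv_bounded_linear)
qed

lemma P1_affine_combination:
  assumes "P1 f" and "sum u B = 1"
  shows "f (\<Sum>b\<in>B. u b *\<^sub>R b) = (\<Sum>b\<in>B. u b *\<^sub>R f b)"
proof -
  obtain l d where l: "linear l" and f: "f = (\<lambda>x. l x + d)"
    using assms(1) by (auto simp: P1_def)
  have "(\<Sum>b\<in>B. u b *\<^sub>R f b) = (\<Sum>b\<in>B. u b *\<^sub>R l b) + sum u B *\<^sub>R d"
    by (simp add: f scaleR_add_right sum.distrib scaleR_left.sum)
  then show ?thesis
    using l assms(2) by (simp add: f linear_sum linear_cmul)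
qed

text \<open>The coordinate of a vertex is the affine function that vanishes on the hyperplane
  through the other vertices, normalised at the vertex itself. Gradient \<open>g a\<close> and
  offset \<open>c a\<close> are kept apart because normals and divergences are read off the
  gradient.\<close>

lemma barycentric_coordinates:
  fixes C :: "'a::euclidean_space set"
  assumes C: "\<not> affine_dependent C" and card: "card C = Suc DIM('a)"
  shows "\<exists>g :: 'a \<Rightarrow> 'a. \<exists>c :: 'a \<Rightarrow> real.
     (\<forall>a\<in>C. \<forall>b\<in>C. g a \<bullet> b + c a = (if a = b then 1 else 0)) \<and>
     (\<forall>u x. sum u C = 1 \<longrightarrow> (\<Sum>a\<in>C. u a *\<^sub>R a) = x \<longrightarrow> (\<forall>a\<in>C. u a = g a \<bullet> x + c a)) \<and>
     (\<forall>x. (\<Sum>a\<in>C. g a \<bullet> x + c a) = 1 \<and> (\<Sum>a\<in>C. (g a \<bullet> x + c a) *\<^sub>R a) = x)"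
proof -
  have fin: "finite C" using C aff_independent_finite by blast
  \<comment> \<open>Gradient and offset form one pair, so that a single choice over the vertices
    provides both.\<close>
  have "\<exists>p::'a \<times> real. \<forall>b\<in>C. fst p \<bullet> b + snd p = (if a = b then 1 else 0)" if a: "a \<in> C" for a
  proof -
    have "\<not> affine_dependent (C - {a})"
      using C affine_independent_Diff by blast
    then have "aff_dim (C - {a}) = int (card (C - {a})) - 1"
      using aff_dim_affine_independent[OF \<open>\<not> affine_dependent (C - {a})\<close>] by linarith
    also have "card (C - {a}) = DIM('a)"
      using a card fin by simp
    finally have "aff_dim (C - {a}) = DIM('a) - 1"
      by simp
    then obtain v r where v: "affine hull (C - {a}) = {x. v \<bullet> x = r}"
      using aff_dim_eq_hyperplane by blast
    have na: "v \<bullet> a \<noteq> r"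
      using C a v unfolding affine_dependent_def by blast
    have "v \<bullet> b = r" if "b \<in> C" "b \<noteq> a" for b
      using hull_inc[of b "C - {a}" affine] that v by auto
    then have "v \<bullet> b / (v \<bullet> a - r) + - r / (v \<bullet> a - r) = (if a = b then 1 else 0)" if "b \<in> C" for b
      using na that \<open>\<And>b. b \<in> C \<Longrightarrow> b \<noteq> a \<Longrightarrow> v \<bullet> b = r\<close>
      by (cases "b = a") (simp_all flip: diff_divide_distrib)
    then have "\<forall>b\<in>C. fst (v /\<^sub>R (v \<bullet> a - r), - r / (v \<bullet> a - r)) \<bullet> b + snd (v /\<^sub>R (v \<bullet> a - r), - r / (v \<bullet> a - r))
        = (if a = b then 1 else 0)"
      by (simp add: divide_inverse mult.commute)
    then show ?thesis by blast
  qed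
  then obtain p :: "'a \<Rightarrow> 'a \<times> real" where
    p: "\<And>a b. a \<in> C \<Longrightarrow> b \<in> C \<Longrightarrow> fst (p a) \<bullet> b + snd (p a) = (if a = b then 1 else 0)"
    by metis
  define g c where "g = fst \<circ> p" and "c = snd \<circ> p"
  have 1: "g a \<bullet> b + c a = (if a = b then 1 else 0)" if "a \<in> C" "b \<in> C" for a b
    using p that by (simp add: g_def c_def)
  have 2: "\<forall>a\<in>C. u a = g a \<bullet> x + c a" if u: "sum u C = 1" "(\<Sum>a\<in>C. u a *\<^sub>R a) = x" for u x
  proof
    fix a assume a: "a \<in> C"
    have "g a \<bullet> x + c a = (\<Sum>b\<in>C. u b * (g a \<bullet> b)) + (\<Sum>b\<in>C. u b) * c a"
      using u by (auto simp: inner_sum_right)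
    also have "\<dots> = (\<Sum>b\<in>C. u b * (g a \<bullet> b + c a))"
      by (simp add: sum_distrib_right sum.distrib distrib_left)
    also have "\<dots> = (\<Sum>b\<in>C. if a = b then u b else 0)"
      using 1[OF a] by (intro sum.cong) auto
    also have "\<dots> = u a" using a fin by simp
    finally show "u a = g a \<bullet> x + c a" by simp
  qed
  have ex: "\<exists>u. sum u C = 1 \<and> (\<Sum>a\<in>C. u a *\<^sub>R a) = x" for x
    using affine_independent_span_eq[OF C card] affine_hull_finite[OF fin] by blast
  have 3: "(\<Sum>a\<in>C. g a \<bullet> x + c a) = 1" for x
    using ex[of x] 2 by (metis (no_types, lifting) sum.cong)
  have 4: "(\<Sum>a\<in>C. (g a \<bullet> x + c a) *\<^sub>R a) = x" for x
  proof -
    obtain u where u: "sum u C = 1" "(\<Sum>a\<in>C. u a *\<^sub>R a) = x" using ex by blast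
    show ?thesis using u(2) 2[OF u] by (simp cong: sum.cong)
  qed
  show ?thesis using 1 2 3 4 by blast
qed


text \<open>This turns the \<open>closest_point\<close> in \<open>face_measure\<close> into an
  explicit affine projection.\<close>

lemma closest_point_hyperplane:
  fixes g :: "'a::euclidean_space"
  assumes "g \<noteq> 0"
  shows "closest_point {x. g \<bullet> x = r} x = x - ((g \<bullet> x - r) / (g \<bullet> g)) *\<^sub>R g"
proof -
  let ?p = "x - ((g \<bullet> x - r) / (g \<bullet> g)) *\<^sub>R g"
  have p: "g \<bullet> ?p = r"
    using assms by (simp add: inner_diff_right)
  have "?p = closest_point {x. g \<bullet> x = r} x"
  proof (rule closest_point_unique)
    show "\<forall>z\<in>{x. g \<bullet> x = r}. dist x ?p \<le> dist x z"
    proof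
      fix z assume "z \<in> {x. g \<bullet> x = r}"
      then have "g \<bullet> (?p - z) = 0"
        using p by (simp add: inner_diff_right)
      then have "orthogonal (x - ?p) (?p - z)"
        by (simp add: orthogonal_def)
      from norm_add_Pythagorean[OF this] have "(norm (x - ?p))\<^sup>2 \<le> (norm (x - z))\<^sup>2"
        by simp
      then show "dist x ?p \<le> dist x z"
        by (simp add: dist_norm)
    qed
  qed (use p in \<open>auto simp: convex_hyperplane closed_hyperplane\<close>)
  then show ?thesis by simp
qed

text \<open>
  Exchanging two vertices of the face and fixing the others and the normal direction is an
  affine involution, so all barycentric coordinates have the same integral.
\<close>

lemma face_integral_P1:
  fixes B :: "'a::euclidean_space set" and f :: "'a \<Rightarrow> 'b::euclidean_space"
  assumes B: "\<not> affine_dependent B" "card B = DIM('a)" and f: "P1 f"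
  shows "face_integral (convex hull B) f
    = face_integral (convex hull B) (\<lambda>_. 1 :: real) *\<^sub>R f ((\<Sum>b\<in>B. b) /\<^sub>R card B)"
proof -
  have fin: "finite B" using B aff_independent_finite by blast
  define A where "A = affine hull B"
  define F where "F = convex hull B"
  have "aff_dim B = DIM('a) - 1"
    using aff_dim_affine_independent[OF B(1)] B(2) by simp
  then obtain n r where n: "n \<noteq> 0" and A: "A = {x. n \<bullet> x = r}"
    unfolding A_def using aff_dim_eq_hyperplane by blast
  have hullF: "affine hull F = A"
    by (simp add: F_def A_def affine_hull_convex_hull)
  define \<pi> where "\<pi> x = x - ((n \<bullet> x - r) / (n \<bullet> n)) *\<^sub>R n" for x
  have cp: "closest_point A = \<pi>"
    using closest_point_hyperplane[OF n] by (auto simp: A \<pi>_def)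
  have \<pi>A: "\<pi> x \<in> A" for x
    using n by (simp add: A \<pi>_def inner_diff_right)
  have clA: "closed A" by (simp add: A closed_hyperplane)
  have dA: "infdist x A = norm (x - \<pi> x)" for x
    using setdist_closest_point[OF clA, of x] \<pi>A by (auto simp: infdist_eq_setdist cp dist_norm)
  obtain b0 where b0: "b0 \<in> B" using B by (metis DIM_positive card.empty equals0I less_irrefl)
  \<comment> \<open>An auxiliary vertex off the hyperplane completes \<open>B\<close> to the
    vertices of a full-dimensional simplex, for which \<open>barycentric_coordinates\<close> is
    available. Points of \<open>A\<close> have coordinate zero at \<open>a\<close>, so the
    coordinates at \<open>B\<close> are those within the face.\<close>
  define a where "a = b0 + n"
  have nB: "n \<bullet> b = r" if "b \<in> B" for b
    using hull_inc[OF that, of affine] A A_def by blast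
  have a: "a \<notin> A" using n nB[OF b0] by (simp add: A a_def inner_add_right)
  then have aB: "a \<notin> B" using hull_inc[of a B] A_def by blast
  have ins: "\<not> affine_dependent (insert a B)" "card (insert a B) = Suc DIM('a)"
    using B a aB fin affine_independent_insert by (auto simp: A_def)
  obtain g c where
    gc1: "\<forall>a'\<in>insert a B. \<forall>b\<in>insert a B. g a' \<bullet> b + c a' = (if a' = b then 1 else 0)"
    and gc2: "\<forall>u x. sum u (insert a B) = 1 \<longrightarrow> (\<Sum>a\<in>insert a B. u a *\<^sub>R a) = x \<longrightarrow>
           (\<forall>a\<in>insert a B. u a = g a \<bullet> x + c a)"
    using barycentric_coordinates[OF ins] by blast
  have coord: "u b = g b \<bullet> x + c b" if "sum u B = 1" "(\<Sum>b\<in>B. u b *\<^sub>R b) = x" "b \<in> B" for u x b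
  proof -
    have e: "sum (u(a := 0)) B = sum u B" "(\<Sum>b\<in>B. (u(a := 0)) b *\<^sub>R b) = (\<Sum>b\<in>B. u b *\<^sub>R b)"
      using aB by (auto intro!: sum.cong)
    have "\<forall>b\<in>insert a B. (u(a := 0)) b = g b \<bullet> x + c b"
      using gc2[THEN spec, of "u(a := 0)", THEN spec, of x] that e aB fin by simp
    then have "(u(a := 0)) b = g b \<bullet> x + c b" using that(3) by blast
    then show ?thesis using that(3) aB by (auto split: if_splits)
  qed
  define \<gamma> where "\<gamma> b x = g b \<bullet> \<pi> x + c b" for b x
  have \<gamma>: "(\<Sum>b\<in>B. \<gamma> b x) = 1 \<and> (\<Sum>b\<in>B. \<gamma> b x *\<^sub>R b) = \<pi> x" for x
  proof -
    obtain u where u: "sum u B = 1" "(\<Sum>b\<in>B. u b *\<^sub>R b) = \<pi> x"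
      using \<pi>A[of x] affine_hull_finite[OF fin] by (auto simp: A_def)
    then show ?thesis using coord[OF u] by (simp add: \<gamma>_def cong: sum.cong)
  qed
  have \<pi>F: "\<pi> x \<in> F \<longleftrightarrow> (\<forall>b\<in>B. 0 \<le> \<gamma> b x)" for x
  proof
    assume "\<pi> x \<in> F"
    then obtain u where u: "\<forall>b\<in>B. 0 \<le> u b" "sum u B = 1" "(\<Sum>b\<in>B. u b *\<^sub>R b) = \<pi> x"
      using convex_hull_finite[OF fin] by (auto simp: F_def)
    then show "\<forall>b\<in>B. 0 \<le> \<gamma> b x" using coord[OF u(2,3)] by (simp add: \<gamma>_def)
  next
    assume "\<forall>b\<in>B. 0 \<le> \<gamma> b x"
    then show "\<pi> x \<in> F"
      using \<gamma>[of x] convex_hull_finite[OF fin] by (auto simp: F_def)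
  qed
  define P where "P = {x. \<pi> x \<in> F \<and> infdist x A \<le> 1 / 2}"
  have cont\<pi>: "continuous_on UNIV \<pi>"
    unfolding \<pi>_def by (intro continuous_intros) (use n in auto)
  have compF: "compact F" unfolding F_def using fin finite_imp_compact_convex_hull by blast
  have "closed P"
  proof -
    have "P = (\<pi> -` F) \<inter> {x. infdist x A \<le> 1 / 2}" by (auto simp: P_def)
    moreover have "closed (\<pi> -` F)"
      using cont\<pi> compF by (intro closed_vimage) (auto simp: compact_imp_closed)
    moreover have "closed {x. infdist x A \<le> 1 / 2}"
      by (intro closed_Collect_le continuous_intros)
    ultimately show ?thesis by auto
  qed
  moreover have "bounded P"
  proof -
    obtain M where M: "\<And>y. y \<in> F \<Longrightarrow> norm y \<le> M"
      using compact_imp_bounded[OF compF] by (auto simp: bounded_iff)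
    have "norm x \<le> M + 1 / 2" if "x \<in> P" for x
      using that M[of "\<pi> x"] dA[of x] norm_triangle_ineq[of "\<pi> x" "x - \<pi> x"] by (simp add: P_def)
    then show ?thesis by (auto simp: bounded_iff)
  qed
  ultimately have compP: "compact P" by (simp add: compact_eq_bounded_closed)
  then have Psets [measurable]: "P \<in> sets borel" by (simp add: borel_closed compact_imp_closed)
  have [measurable]: "\<pi> \<in> borel_measurable borel"
    using cont\<pi> by (rule borel_measurable_continuous_onI)
  have face: "face_integral F h = (\<integral>x. indicator P x *\<^sub>R h (\<pi> x) \<partial>lborel)"
    if "continuous_on UNIV h" for h :: "'a \<Rightarrow> 'c::euclidean_space"
  proof -
    have [measurable]: "h \<in> borel_measurable borel"
      using that by (rule borel_measurable_continuous_onI)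
    have "face_integral F h = (\<integral>x. h (\<pi> x) \<partial>restrict_space lborel P)"
      unfolding face_measure_def hullF cp P_def[symmetric]
      by (intro integral_distr measurable_restrict_space1) auto
    also have "\<dots> = (\<integral>x. indicator P x *\<^sub>R h (\<pi> x) \<partial>lborel)"
      by (rule integral_restrict_space) simp
    finally show ?thesis .
  qed
  define I where "I b = (\<integral>x. indicator P x *\<^sub>R \<gamma> b x \<partial>lborel)" for b
  have cont\<gamma>: "continuous_on S (\<gamma> b)" for b S
    unfolding \<gamma>_def by (intro continuous_intros continuous_on_subset[OF cont\<pi>]) auto
  have int\<gamma>: "integrable lborel (\<lambda>x. indicator P x *\<^sub>R \<gamma> b x)" for b
    by (rule borel_integrable_compact[OF compP cont\<gamma>])
  have swap: "I b = I b'" if b: "b \<in> B" "b' \<in> B" "b \<noteq> b'" for b b'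
  proof -
    \<comment> \<open>Moving \<open>x\<close> along \<open>b - b'\<close> adds the step to
      \<open>\<gamma> b\<close> and takes it from \<open>\<gamma> b'\<close>; a step equal to their
      difference exchanges the two values. The direction is tangential, so the offset from the
      hyperplane stays the same and the prism \<open>P\<close> is preserved.\<close>
    define h where "h x = \<gamma> b' x - \<gamma> b x" for x
    define T where "T x = x + h x *\<^sub>R (b - b')" for x
    have n0: "n \<bullet> (b - b') = 0"
      using b nB by (simp add: inner_diff_right)
    have \<pi>T: "\<pi> (T x) = \<pi> x + h x *\<^sub>R (b - b')" for x
      by (simp add: T_def \<pi>_def inner_add_right n0)
    have \<gamma>T: "\<gamma> d (T x) = \<gamma> d x + h x * ((if d = b then 1 else 0) - (if d = b' then 1 else 0))"
      if d: "d \<in> B" for d x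
    proof -
      have "g d \<bullet> (b - b') = (if d = b then 1 else 0) - (if d = b' then 1 else 0)"
        using gc1[rule_format, of d b] gc1[rule_format, of d b'] d b by (simp add: inner_diff_right)
      then show ?thesis by (simp add: \<gamma>_def \<pi>T inner_add_right)
    qed
    have hT: "h (T x) = - h x" for x
      using b \<gamma>T[of b x] \<gamma>T[of b' x] by (simp add: h_def)
    have TT: "T (T x) = x" for x
      by (subst T_def) (simp add: hT, simp add: T_def)
    have "P1 T"
    proof -
      \<comment> \<open>As \<open>h\<close> sees \<open>x\<close> only through the projection \<pi>,
        its gradient is the tangential part \<open>w\<close> of \<open>v\<close>.\<close>
      define v w where "v = g b' - g b" and "w = v - (v \<bullet> n / (n \<bullet> n)) *\<^sub>R n"
      have "h x = v \<bullet> \<pi> x + (c b' - c b)" for x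
        by (simp add: h_def \<gamma>_def v_def inner_diff_left)
      then have "h x = w \<bullet> x + (r * (v \<bullet> n) / (n \<bullet> n) + c b' - c b)" for x
        by (simp add: \<pi>_def w_def inner_diff_right inner_diff_left diff_divide_distrib algebra_simps)
      then obtain k where h: "\<And>x. h x = w \<bullet> x + k" by blast
      have "linear (\<lambda>x. x + (w \<bullet> x) *\<^sub>R (b - b'))"
        by (intro linearI) (simp_all add: inner_add_right scaleR_add_left scaleR_add_right)
      then show ?thesis
        unfolding P1_def T_def h
        by (intro exI[of _ "\<lambda>x. x + (w \<bullet> x) *\<^sub>R (b - b')"] exI[of _ "k *\<^sub>R (b - b')"])
           (simp add: scaleR_add_left add.assoc)
    qed
    have mT [measurable]: "T \<in> borel_measurable borel"
      by (intro borel_measurable_continuous_onI P1_continuous_on \<open>P1 T\<close>)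
    have TP: "T x \<in> P" if "x \<in> P" for x
    proof -
      have "\<forall>d\<in>B. 0 \<le> \<gamma> d (T x)"
        using \<gamma>T that b by (auto simp: P_def \<pi>F h_def)
      moreover have "T x - \<pi> (T x) = x - \<pi> x" by (simp add: \<pi>T) (simp add: T_def)
      ultimately show ?thesis using that by (simp add: P_def \<pi>F dA)
    qed
    then have TP': "T x \<in> P \<longleftrightarrow> x \<in> P" for x using TT by metis
    have [measurable]: "\<gamma> b \<in> borel_measurable borel"
      by (rule borel_measurable_continuous_onI[OF cont\<gamma>])
    have "I b = (\<integral>x. indicator P x *\<^sub>R \<gamma> b x \<partial>distr lborel borel T)"
      by (simp add: I_def lborel_distr_affine_involution[OF \<open>P1 T\<close> TT])
    also have "\<dots> = (\<integral>x. indicator P (T x) *\<^sub>R \<gamma> b (T x) \<partial>lborel)"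
      by (rule integral_distr) auto
    also have "\<dots> = I b'"
      using b by (simp add: I_def \<gamma>T h_def TP' indicator_def)
    finally show ?thesis .
  qed
  define M where "M = face_integral F (\<lambda>_. 1 :: real)"
  \<comment> \<open>The coordinates add up to 1, so their equal integrals add up to the area and
    each is the area over the number of vertices.\<close>
  have "(\<Sum>b\<in>B. I b) = (\<integral>x. (\<Sum>b\<in>B. indicator P x *\<^sub>R \<gamma> b x) \<partial>lborel)"
    unfolding I_def using int\<gamma> by (intro Bochner_Integration.integral_sum[symmetric]) auto
  also have "\<dots> = M"
    unfolding M_def face[OF continuous_on_const] using \<gamma> by (simp flip: sum_distrib_left)
  finally have "(\<Sum>b\<in>B. I b) = M" .
  moreover have "(\<Sum>b\<in>B. I b) = (\<Sum>b\<in>B. I b0)"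
    by (rule sum.cong) (use swap b0 in metis)+
  ultimately have "real (card B) * I b0 = M"
    by simp
  then have Ib: "I b = M / card B" if "b \<in> B" for b
    using swap[OF that b0] B by (cases "b = b0") (auto simp: field_simps)
  have "face_integral F f = (\<integral>x. (\<Sum>b\<in>B. (indicator P x *\<^sub>R \<gamma> b x) *\<^sub>R f b) \<partial>lborel)"
  proof -
    have "f (\<pi> x) = (\<Sum>b\<in>B. \<gamma> b x *\<^sub>R f b)" for x
      using P1_affine_combination[OF f, of "\<lambda>b. \<gamma> b x" B] \<gamma>[of x] by simp
    then show ?thesis
      by (simp add: face P1_continuous_on[OF f] scaleR_right.sum)
  qed
  also have "\<dots> = (\<Sum>b\<in>B. I b *\<^sub>R f b)"
    unfolding I_def using int\<gamma> by (subst Bochner_Integration.integral_sum) (auto intro!: sum.cong integral_scaleR_left)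
  also have "\<dots> = (\<Sum>b\<in>B. M *\<^sub>R ((1 / card B) *\<^sub>R f b))"
    by (intro sum.cong) (auto simp: Ib)
  also have "\<dots> = M *\<^sub>R (\<Sum>b\<in>B. (1 / card B) *\<^sub>R f b)"
    by (simp add: scaleR_right.sum)
  also have "(\<Sum>b\<in>B. (1 / card B) *\<^sub>R f b) = f (\<Sum>b\<in>B. (1 / card B) *\<^sub>R b)"
    using B by (subst P1_affine_combination[OF f]) auto
  also have "(\<Sum>b\<in>B. (1 / card B) *\<^sub>R b) = (\<Sum>b\<in>B. b) /\<^sub>R card B"
    by (simp add: scaleR_right.sum inverse_eq_divide)
  finally show ?thesis by (simp add: M_def F_def)
qed

section \<open>Facets of simplices\<close>

text \<open>Extreme points are determined by the set alone, so a facet has the same centroid from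
  each of the cells that contain it.\<close>

definition vertex_centroid :: "'a::euclidean_space set \<Rightarrow> 'a" where
  "vertex_centroid F = (\<Sum>v | v extreme_point_of F. v) /\<^sub>R card {v. v extreme_point_of F}"

text \<open>
  \<open>g \<bullet> x + c\<close> is the barycentric coordinate that vanishes on the facet \<open>F\<close>.
\<close>

definition facet_coordinate :: "'a::euclidean_space set \<Rightarrow> 'a set \<Rightarrow> 'a \<Rightarrow> real \<Rightarrow> bool" where
  "facet_coordinate K F g c \<longleftrightarrow>
     g \<noteq> 0 \<and> affine hull F = {x. g \<bullet> x + c = 0} \<and>
     (\<forall>x\<in>rel_interior F. \<exists>r>0. K \<inter> ball x r = {y \<in> ball x r. 0 \<le> g \<bullet> y + c}) \<and>
     (\<forall>F'. F' facet_of K \<longrightarrow>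
        g \<bullet> vertex_centroid F' + c = (if F' = F then 0 else 1 / DIM('a)))"

lemma facet_coordinateD:
  assumes "facet_coordinate K F g c"
  shows "g \<noteq> 0"
    and "y \<in> affine hull F \<longleftrightarrow> g \<bullet> y + c = 0"
    and "x \<in> rel_interior F \<Longrightarrow> \<exists>r>0. K \<inter> ball x r = {y \<in> ball x r. 0 \<le> g \<bullet> y + c}"
    and "x \<in> F \<Longrightarrow> g \<bullet> x + c = 0"
  using assms hull_inc[of x F affine] unfolding facet_coordinate_def by blast+

lemma facet_coordinate_centroid:
  fixes K :: "'a::euclidean_space set"
  assumes "facet_coordinate K F g c" "F' facet_of K"
  shows "g \<bullet> vertex_centroid F' + c = (if F' = F then 0 else 1 / DIM('a))"
  using assms unfolding facet_coordinate_def by blast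

lemma vertex_centroid_convex_hull:
  assumes "\<not> affine_dependent B"
  shows "vertex_centroid (convex hull B) = (\<Sum>b\<in>B. b) /\<^sub>R card B"
  by (simp add: vertex_centroid_def extreme_point_of_convex_hull_affine_independent[OF assms])

lemma simplex_facetE:
  fixes K :: "'a::euclidean_space set"
  assumes "int DIM('a) simplex K" and "F facet_of K"
  obtains C a where "\<not> affine_dependent C" "card C = Suc DIM('a)" "finite C" "K = convex hull C"
    "a \<in> C" "F = convex hull (C - {a})" "C - {a} \<noteq> {}"
proof -
  obtain C where C: "\<not> affine_dependent C" "int (card C) = int DIM('a) + 1" "K = convex hull C"
    using assms(1) by (auto simp: simplex_def)
  then obtain a where "a \<in> C" "F = convex hull (C - {a})" "F \<noteq> {}"
    using assms(2) facet_of_convex_hull_affine_independent by blast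
  moreover have "finite C" using C(1) by (rule aff_independent_finite)
  moreover have "card C = Suc DIM('a)" using C(2) by linarith
  moreover have "C - {a} \<noteq> {}" using \<open>F = _\<close> \<open>F \<noteq> {}\<close> by auto
  ultimately show thesis using C(1,3) that by blast
qed

lemma face_integral_facet:
  fixes K :: "'a::euclidean_space set" and f :: "'a \<Rightarrow> 'b::euclidean_space"
  assumes "int DIM('a) simplex K" and "F facet_of K" and "P1 f"
  shows "face_integral F f = face_integral F (\<lambda>_. 1 :: real) *\<^sub>R f (vertex_centroid F)"
proof -
  obtain C a where C: "\<not> affine_dependent C" "card C = Suc DIM('a)" "finite C"
    "a \<in> C" "F = convex hull (C - {a})"
    by (rule simplex_facetE[OF assms(1,2)]) (rule that)
  have "\<not> affine_dependent (C - {a})" "card (C - {a}) = DIM('a)"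
    using C affine_independent_Diff by auto
  from face_integral_P1[OF this assms(3)] vertex_centroid_convex_hull[OF this(1)] show ?thesis
    using C(5) by simp
qed

text \<open>The coordinate belongs to the vertex \<open>a\<close> opposite to \<open>F\<close>. Near
  a relatively interior point of \<open>F\<close> all other coordinates stay positive, so its sign
  alone decides membership in \<open>K\<close>. Any other facet has \<open>a\<close> among its
  vertices, and its centroid gives \<open>a\<close> the weight \<open>1 / DIM('a)\<close>.\<close>

lemma facet_coordinate_exists:
  fixes K :: "'a::euclidean_space set"
  assumes "int DIM('a) simplex K" and "F facet_of K"
  shows "\<exists>g c. facet_coordinate K F g c"
proof -
  obtain C a where C: "\<not> affine_dependent C" "card C = Suc DIM('a)" and fin: "finite C"
    and K: "K = convex hull C" and a: "a \<in> C" and F: "F = convex hull (C - {a})"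
    and ne: "C - {a} \<noteq> {}"
    by (rule simplex_facetE[OF assms]) (rule that)
  obtain g c where
    gc1: "\<forall>a\<in>C. \<forall>b\<in>C. g a \<bullet> b + c a = (if a = b then 1 else 0)"
    and gc2: "\<forall>u x. sum u C = 1 \<longrightarrow> (\<Sum>a\<in>C. u a *\<^sub>R a) = x \<longrightarrow> (\<forall>a\<in>C. u a = g a \<bullet> x + c a)"
    and gc3: "\<forall>x. (\<Sum>a\<in>C. g a \<bullet> x + c a) = 1 \<and> (\<Sum>a\<in>C. (g a \<bullet> x + c a) *\<^sub>R a) = x"
    using barycentric_coordinates[OF C] by blast
  have indep: "\<not> affine_dependent (C - {b})" for b
    using C(1) affine_independent_Diff by blast
  have "g a \<noteq> 0"
  proof
    assume "g a = 0"
    moreover obtain b where "b \<in> C" "b \<noteq> a" using ne by blast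
    ultimately show False using gc1[rule_format, of a a] gc1[rule_format, of a b] a by simp
  qed
  moreover have "affine hull F = {x. g a \<bullet> x + c a = 0}"
  proof
    have "affine hull (C - {a}) \<subseteq> {x. g a \<bullet> x = - c a}"
      using gc1 a by (intro hull_minimal affine_hyperplane) (auto simp: eq_neg_iff_add_eq_0)
    then show "affine hull F \<subseteq> {x. g a \<bullet> x + c a = 0}"
      by (auto simp: F affine_hull_convex_hull eq_neg_iff_add_eq_0)
    show "{x. g a \<bullet> x + c a = 0} \<subseteq> affine hull F"
    proof
      fix x assume "x \<in> {x. g a \<bullet> x + c a = 0}"
      then have x: "g a \<bullet> x + c a = 0" by simp
      have "(\<Sum>b\<in>C - {a}. g b \<bullet> x + c b) = 1" "(\<Sum>b\<in>C - {a}. (g b \<bullet> x + c b) *\<^sub>R b) = x"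
        using gc3[rule_format, of x] x sum.remove[OF fin a, of "\<lambda>b. g b \<bullet> x + c b"]
          sum.remove[OF fin a, of "\<lambda>b. (g b \<bullet> x + c b) *\<^sub>R b"] by simp_all
      then show "x \<in> affine hull F"
        unfolding F affine_hull_convex_hull using affine_hull_finite[of "C - {a}"] fin by auto
    qed
  qed
  moreover have "\<exists>r>0. K \<inter> ball x r = {y \<in> ball x r. 0 \<le> g a \<bullet> y + c a}" if "x \<in> rel_interior F" for x
  proof -
    have "x \<in> rel_interior (convex hull (C - {a}))" using that by (simp only: F)
    then obtain u where u: "\<forall>b\<in>C - {a}. 0 < u b" "sum u (C - {a}) = 1" "(\<Sum>b\<in>C - {a}. u b *\<^sub>R b) = x"
      unfolding rel_interior_convex_hull_explicit[OF indep] by auto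
    \<comment> \<open>\<open>gc2\<close> takes weights on all of \<open>C\<close>, so
      \<open>u\<close> is extended by the weight zero at \<open>a\<close>.\<close>
    define w where "w b = (if b = a then 0 else u b)" for b
    have wa: "w a = 0" and wu: "\<And>b. b \<in> C - {a} \<Longrightarrow> w b = u b" by (auto simp: w_def)
    have "sum w C = sum w (C - {a})"
      using sum.remove[OF fin a, of w] wa by simp
    also have "\<dots> = sum u (C - {a})"
      by (intro sum.cong wu refl)
    finally have w1: "sum w C = 1" using u(2) by simp
    have "(\<Sum>b\<in>C. w b *\<^sub>R b) = (\<Sum>b\<in>C - {a}. w b *\<^sub>R b)"
      using sum.remove[OF fin a, of "\<lambda>b. w b *\<^sub>R b"] wa by simp
    also have "(\<Sum>b\<in>C - {a}. w b *\<^sub>R b) = (\<Sum>b\<in>C - {a}. u b *\<^sub>R b)"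
      by (intro sum.cong) (simp_all add: wu)
    finally have w2: "(\<Sum>b\<in>C. w b *\<^sub>R b) = x" using u(3) by simp
    have w: "\<forall>b\<in>C. w b = g b \<bullet> x + c b"
      by (rule gc2[THEN spec, THEN spec, THEN mp, THEN mp, OF w1 w2])
    have pos: "0 < g b \<bullet> x + c b" if "b \<in> C - {a}" for b
    proof -
      have "w b = g b \<bullet> x + c b" "w b = u b" using w wu that by blast+
      then show ?thesis using u(1) that by (metis)
    qed
    define U where "U = (\<Inter>b\<in>C - {a}. {y. 0 < g b \<bullet> y + c b})"
    have "open U"
      unfolding U_def using fin by (intro open_INT ballI open_Collect_less continuous_intros) auto
    moreover have "x \<in> U" using pos by (auto simp: U_def)
    ultimately obtain r where r: "r > 0" "ball x r \<subseteq> U" using open_contains_ball by blast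
    have "K \<inter> ball x r = {y \<in> ball x r. 0 \<le> g a \<bullet> y + c a}"
    proof (intro equalityI subsetI)
      fix y assume "y \<in> K \<inter> ball x r"
      then obtain v where v: "\<forall>b\<in>C. 0 \<le> v b" "sum v C = 1" "(\<Sum>b\<in>C. v b *\<^sub>R b) = y" "y \<in> ball x r"
        unfolding K convex_hull_finite[OF fin] by auto
      have "v a = g a \<bullet> y + c a"
        using gc2[THEN spec, THEN spec, THEN mp, THEN mp, OF v(2,3)] a by blast
      then show "y \<in> {y \<in> ball x r. 0 \<le> g a \<bullet> y + c a}"
        using v(1,4) a by (metis (mono_tags, lifting) mem_Collect_eq)
    next
      fix y assume y: "y \<in> {y \<in> ball x r. 0 \<le> g a \<bullet> y + c a}"
      have nonneg: "0 \<le> g b \<bullet> y + c b" if "b \<in> C" for b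
      proof (cases "b = a")
        case False
        have "y \<in> U" using r(2) y by blast
        then have "0 < g b \<bullet> y + c b" using that False unfolding U_def by blast
        then show ?thesis by simp
      qed (use y in simp)
      have "y \<in> K"
        unfolding K convex_hull_finite[OF fin] mem_Collect_eq
        using nonneg gc3 by (intro exI[of _ "\<lambda>b. g b \<bullet> y + c b"]) blast
      then show "y \<in> K \<inter> ball x r" using y by blast
    qed
    then show ?thesis using r(1) by blast
  qed
  moreover have "g a \<bullet> vertex_centroid F' + c a = (if F' = F then 0 else 1 / DIM('a))"
    if F': "F' facet_of K" for F'
  proof -
    obtain b where b: "b \<in> C" "F' = convex hull (C - {b})"
      using F' unfolding K facet_of_convex_hull_affine_independent[OF C(1)] by auto
    \<comment> \<open>Extreme points recover the vertices from the hull, so omitting different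
      vertices gives different facets.\<close>
    have ext: "(x extreme_point_of F') = (x \<in> C - {b})" "(x extreme_point_of F) = (x \<in> C - {a})" for x
      unfolding b(2) F by (simp_all only: extreme_point_of_convex_hull_affine_independent[OF indep])
    have iff: "F' = F \<longleftrightarrow> a = b"
    proof
      assume "F' = F"
      then have "a \<in> C - {b} \<longleftrightarrow> a \<in> C - {a}" using ext[of a] by simp
      then show "a = b" using a by blast
    qed (simp add: b F)
    have card: "card (C - {b}) = DIM('a)" using b C fin by simp
    have "g a \<bullet> vertex_centroid F' + c a = (\<Sum>d\<in>C - {b}. g a \<bullet> d) / DIM('a) + c a"
      unfolding b(2) vertex_centroid_convex_hull[OF indep] card
      by (simp add: inner_sum_right divide_inverse mult.commute)
    also have "\<dots> = (\<Sum>d\<in>C - {b}. g a \<bullet> d + c a) / DIM('a)"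
      by (simp add: sum.distrib card add_divide_distrib)
    also have "(\<Sum>d\<in>C - {b}. g a \<bullet> d + c a) = (\<Sum>d\<in>C - {b}. if a = d then 1 else 0)"
      using gc1 a by (intro sum.cong) auto
    also have "\<dots> = (if a = b then 0 else 1)"
      using fin a by simp
    finally show ?thesis by (simp add: iff)
  qed
  ultimately have "facet_coordinate K F (g a) (c a)"
    unfolding facet_coordinate_def by blast
  then show ?thesis by blast
qed

text \<open>Above the graph of \<phi> there is an open set free of \<Omega> that comes arbitrarily
  close to each frontier point. This excludes slits, whose points would be frontier points of
  \<Omega> but interior to its closure.\<close>

lemma frontier_Int_interior_closure:
  assumes "open \<Omega>" and "lipschitz_boundary \<Omega>"
  shows "frontier \<Omega> \<inter> interior (closure \<Omega>) = {}"
proof (rule ccontr)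
  assume "frontier \<Omega> \<inter> interior (closure \<Omega>) \<noteq> {}"
  then obtain x where x: "x \<in> frontier \<Omega>" "x \<in> interior (closure \<Omega>)" by blast
  then obtain U e L \<phi> where U: "open U" "x \<in> U" and e: "norm e = 1"
    and lip: "L-lipschitz_on {y. y \<bullet> e = 0} \<phi>"
    and eq: "\<Omega> \<inter> U = {y \<in> U. y \<bullet> e < \<phi> (y - (y \<bullet> e) *\<^sub>R e)}"
    using assms(2) unfolding lipschitz_boundary_def by meson
  have ee: "e \<bullet> e = 1" using e by (simp add: norm_eq_1)
  \<comment> \<open>The height above the graph: negative on \<Omega> within \<open>U\<close>, and
    continuous, so that positive height defines an open set.\<close>
  define k where "k y = y \<bullet> e - \<phi> (y - (y \<bullet> e) *\<^sub>R e)" for y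
  have "continuous_on UNIV (\<lambda>y. \<phi> (y - (y \<bullet> e) *\<^sub>R e))"
    by (rule continuous_on_compose2[OF lipschitz_on_continuous_on[OF lip]])
       (auto intro!: continuous_intros simp: inner_diff_left ee)
  then have contk: "continuous_on UNIV k"
    unfolding k_def by (intro continuous_intros)
  define W where "W = U \<inter> {y. 0 < k y}"
  have "open W"
    unfolding W_def using U contk by (intro open_Int open_Collect_less continuous_intros) auto
  have neg: "k y < 0" if "y \<in> \<Omega>" "y \<in> U" for y
  proof -
    have "y \<in> {y \<in> U. y \<bullet> e < \<phi> (y - (y \<bullet> e) *\<^sub>R e)}" using that eq by blast
    then show ?thesis by (simp add: k_def)
  qed
  then have "W \<inter> \<Omega> = {}" by (force simp: W_def)
  with \<open>open W\<close> have W: "W \<inter> closure \<Omega> = {}"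
    using open_Int_closure_eq_empty by blast
  have "x \<notin> \<Omega>" using x(1) assms(1) by (simp add: frontier_def interior_open)
  have kx: "0 \<le> k x"
  proof (rule ccontr)
    assume "\<not> 0 \<le> k x"
    then have "x \<in> {y \<in> U. y \<bullet> e < \<phi> (y - (y \<bullet> e) *\<^sub>R e)}" using U(2) by (simp add: k_def)
    then show False using eq \<open>x \<notin> \<Omega>\<close> by blast
  qed
  have "open (U \<inter> interior (closure \<Omega>))" "x \<in> U \<inter> interior (closure \<Omega>)" using U x by auto
  then obtain r where r: "r > 0" "ball x r \<subseteq> U \<inter> interior (closure \<Omega>)"
    using open_contains_ball by blast
  \<comment> \<open>A move along \<open>e\<close> keeps the base point of the graph, so the height
    grows by exactly the length of the move, while \<open>y\<close> is still in the closure.\<close>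
  define y where "y = x + (r / 2) *\<^sub>R e"
  have "y \<in> ball x r" using r(1) e by (simp add: y_def dist_norm)
  then have y: "y \<in> U" "y \<in> closure \<Omega>" using r interior_subset by blast+
  have "k y = k x + r / 2"
    by (simp add: k_def y_def inner_add_left ee algebra_simps)
  then have "y \<in> W" using kx r(1) y by (simp add: W_def)
  with y W show False by blast
qed

section \<open>Facets in a simplicial mesh\<close>

locale simplicial_domain =
  fixes \<Omega> :: "(real^'n) set" and \<T> :: "(real^'n) set set"
  assumes domain: "polyhedral_lipschitz_domain \<Omega>" and mesh: "simplicial_mesh \<Omega> \<T>"
begin

section \<open>Cells of the mesh and their intersections\<close>

lemma open_domain: "open \<Omega>"
  using domain by (simp add: polyhedral_lipschitz_domain_def)

text \<open>The union of the cells is only the closure; this is the way back from cells to \<Omega>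
  itself.\<close>

lemma interior_closure_domain: "interior (closure \<Omega>) = \<Omega>"
proof
  have "frontier \<Omega> \<inter> interior (closure \<Omega>) = {}"
    using domain by (intro frontier_Int_interior_closure) (simp_all add: polyhedral_lipschitz_domain_def)
  moreover have "frontier \<Omega> = closure \<Omega> - \<Omega>"
    using open_domain by (simp add: frontier_def interior_open)
  ultimately show "interior (closure \<Omega>) \<subseteq> \<Omega>"
    using interior_subset[of "closure \<Omega>"] by blast
  show "\<Omega> \<subseteq> interior (closure \<Omega>)"
    using open_domain by (simp add: closure_subset interior_maximal)
qed

lemma finite_mesh: "finite \<T>"
  using mesh by (simp add: simplicial_mesh_def triangulation_def)

lemma Union_mesh: "\<Union>\<T> = closure \<Omega>"
  using mesh by (simp add: simplicial_mesh_def)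

lemma cell_simplex: "K \<in> \<T> \<Longrightarrow> int DIM(real^'n) simplex K"
  using mesh by (simp add: simplicial_mesh_def)

lemma cell_aff_dim: "K \<in> \<T> \<Longrightarrow> aff_dim K = CARD('n)"
  using cell_simplex aff_dim_simplex by fastforce

lemma cell_convex: "K \<in> \<T> \<Longrightarrow> convex K"
  using cell_simplex convex_simplex by blast

lemma cell_closed: "K \<in> \<T> \<Longrightarrow> closed K"
  using cell_simplex compact_simplex compact_imp_closed by blast

lemma interior_cell_nonempty:
  assumes "K \<in> \<T>"
  shows "interior K \<noteq> {}"
proof -
  have "affine hull K = UNIV"
    using cell_aff_dim[OF assms] by (simp flip: aff_dim_eq_full)
  moreover have "K \<noteq> {}"
    using cell_aff_dim[OF assms] by (metis aff_dim_empty of_nat_0_le_iff neg_0_le_iff_le not_one_le_zero)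
  ultimately show ?thesis
    using rel_interior_interior rel_interior_eq_empty[OF cell_convex[OF assms]] by metis
qed

lemma cell_Int_face: "K \<in> \<T> \<Longrightarrow> K' \<in> \<T> \<Longrightarrow> K \<inter> K' face_of K"
  using mesh by (simp add: simplicial_mesh_def triangulation_def)

text \<open>Otherwise \<open>K\<close> would be a proper face of \<open>K'\<close> and have smaller
  dimension, but all cells are of full dimension.\<close>

lemma cell_Int_neq:
  assumes "K \<in> \<T>" "K' \<in> \<T>" "K \<noteq> K'"
  shows "K \<inter> K' \<noteq> K"
proof
  assume "K \<inter> K' = K"
  then have "K face_of K'"
    using cell_Int_face[OF assms(2,1)] by (simp add: Int_commute)
  from face_of_aff_dim_lt[OF cell_convex[OF assms(2)] this assms(3)] show False
    using cell_aff_dim[OF assms(1)] cell_aff_dim[OF assms(2)] by simp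
qed

lemma interior_cell_disjoint:
  assumes "K \<in> \<T>" "K' \<in> \<T>" "K \<noteq> K'"
  shows "interior K \<inter> K' = {}"
proof -
  have "(K \<inter> K') \<inter> interior K = {}"
    by (rule face_of_disjoint_interior[OF cell_Int_face[OF assms(1,2)] cell_Int_neq[OF assms]])
  then show ?thesis using interior_subset by blast
qed

text \<open>A face of \<open>K\<close> that contains a relatively interior point of \<open>F\<close>
  contains all of \<open>F\<close>. Hence the proper face \<open>K \<inter> K'\<close> has the
  dimension of \<open>F\<close> and coincides with it: conformity excludes hanging vertices and
  partly overlapping facets.\<close>

lemma facet_Int_cell:
  assumes K: "K \<in> \<T>" "K' \<in> \<T>" "K \<noteq> K'" and F: "F facet_of K"
    and x: "x \<in> rel_interior F" "x \<in> K'"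
  shows "F = K \<inter> K'" and "F facet_of K'"
proof -
  have FK: "F face_of K" "F \<noteq> {}" "aff_dim F = int CARD('n) - 1"
    using F cell_aff_dim[OF K(1)] by (auto simp: facet_of_def)
  have "F \<subseteq> K \<inter> K'"
    using x rel_interior_subset[of F] face_of_imp_subset[OF FK(1)]
    by (intro subset_of_face_of[OF cell_Int_face[OF K(1,2)]]) auto
  then have "F face_of K \<inter> K'"
    using FK(1) by (intro face_of_subset[OF FK(1)]) auto
  moreover have "aff_dim (K \<inter> K') < CARD('n)"
    using face_of_aff_dim_lt[OF cell_convex[OF K(1)] cell_Int_face[OF K(1,2)] cell_Int_neq[OF K]]
      cell_aff_dim[OF K(1)] by simp
  moreover have "convex (K \<inter> K')" using K cell_convex convex_Int by blast
  ultimately show eq: "F = K \<inter> K'"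
    using face_of_aff_dim_lt[of "K \<inter> K'" F] FK(3) by linarith
  have "F face_of K'"
    unfolding eq using cell_Int_face[OF K(2,1)] by (simp only: Int_commute)
  then show "F facet_of K'"
    using FK cell_aff_dim[OF K(2)] by (simp add: facet_of_def)
qed

lemma rel_interior_facet_nonempty:
  assumes "F facet_of K"
  shows "\<exists>x. x \<in> rel_interior F"
proof -
  have "convex F" "F \<noteq> {}"
    using assms face_of_imp_convex by (auto simp: facet_of_def)
  then show ?thesis using rel_interior_eq_empty by blast
qed

text \<open>Both coordinates vanish on the same hyperplane and are therefore proportional. With a
  nonnegative factor both cells would lie on the same side near a relatively interior point of
  \<open>F\<close> and share points off the hyperplane, but they only share
  \<open>F\<close>.\<close>

lemma facet_coordinate_opposite:
  assumes K: "K \<in> \<T>" "K' \<in> \<T>" "K \<noteq> K'" and F: "F facet_of K" "F facet_of K'"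
    and gc: "facet_coordinate K F g c" and gc': "facet_coordinate K' F g' c'"
  shows "\<exists>t<0. g' = t *\<^sub>R g \<and> c' = t * c"
proof -
  obtain x where x: "x \<in> rel_interior F" using rel_interior_facet_nonempty[OF F(1)] by blast
  then have "x \<in> K'" using F(2) facet_of_imp_subset rel_interior_subset by blast
  then have FI: "F = K \<inter> K'" using facet_Int_cell[OF K F(1) x] by blast
  have g0: "g \<noteq> 0" "g \<bullet> g > 0" using facet_coordinateD(1)[OF gc] by auto
  have hull: "g \<bullet> y + c = 0 \<longleftrightarrow> g' \<bullet> y + c' = 0" for y
    using facet_coordinateD(2)[OF gc] facet_coordinateD(2)[OF gc'] by blast
  \<comment> \<open>Pairing the expected \<open>g' = t g\<close> with \<open>g\<close> gives this
    factor; the identity follows by evaluating at the projection \<open>?p\<close>, where both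
    coordinates vanish.\<close>
  define t where "t = (g' \<bullet> g) / (g \<bullet> g)"
  have scaled: "g' \<bullet> y + c' = t * (g \<bullet> y + c)" for y
  proof -
    let ?p = "y - ((g \<bullet> y + c) / (g \<bullet> g)) *\<^sub>R g"
    have "g \<bullet> ?p + c = 0" using g0 by (simp add: inner_diff_right)
    then have "g' \<bullet> ?p + c' = 0" using hull by blast
    then show ?thesis by (simp add: t_def inner_diff_right mult.commute)
  qed
  have c': "c' = t * c" using scaled[of 0] by simp
  have g': "g' = t *\<^sub>R g"
  proof -
    have "g' \<bullet> y = (t *\<^sub>R g) \<bullet> y" for y using scaled[of y] c' by (simp add: distrib_left)
    then show ?thesis by (metis vector_eq_rdot)
  qed
  have "t < 0"
  proof (rule ccontr)
    assume "\<not> t < 0"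
    obtain r where r: "r > 0" "K \<inter> ball x r = {y \<in> ball x r. 0 \<le> g \<bullet> y + c}"
      using facet_coordinateD(3)[OF gc x] by blast
    obtain r' where r': "r' > 0" "K' \<inter> ball x r' = {y \<in> ball x r'. 0 \<le> g' \<bullet> y + c'}"
      using facet_coordinateD(3)[OF gc' x] by blast
    \<comment> \<open>The step along \<open>g\<close> has half the smaller radius as its length, so
      \<open>y\<close> stays in both balls.\<close>
    define s where "s = min r r' / (2 * norm g)"
    define y where "y = x + s *\<^sub>R g"
    have "s > 0" using r r' g0 by (simp add: s_def)
    have "norm (s *\<^sub>R g) = min r r' / 2" using r(1) r'(1) g0 by (simp add: s_def)
    then have y: "y \<in> ball x r" "y \<in> ball x r'" using r(1) r'(1) by (auto simp: y_def dist_norm)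
    have "g \<bullet> x + c = 0"
      using x rel_interior_subset facet_coordinateD(4)[OF gc] by blast
    then have gy: "g \<bullet> y + c = s * (g \<bullet> g)" by (simp add: y_def inner_add_right)
    then have "0 \<le> g \<bullet> y + c" "0 \<le> g' \<bullet> y + c'"
      using scaled[of y] \<open>\<not> t < 0\<close> \<open>s > 0\<close> g0 by auto
    then have "y \<in> F" using y r(2) r'(2) FI by blast
    then have "g \<bullet> y + c = 0"
      by (rule facet_coordinateD(4)[OF gc])
    then show False using gy \<open>s > 0\<close> g0 by simp
  qed
  then show ?thesis using g' c' by blast
qed

text \<open>The gradients for three different cells would be pairwise negative multiples of each
  other, whereas the product of two negative factors is positive.\<close>

lemma facet_at_most_two_cells:
  assumes "K1 \<in> \<T>" "K2 \<in> \<T>" "K3 \<in> \<T>" "F facet_of K1" "F facet_of K2" "F facet_of K3"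
    and "K1 \<noteq> K2" "K1 \<noteq> K3"
  shows "K2 = K3"
proof (rule ccontr)
  assume "K2 \<noteq> K3"
  obtain g1 c1 where gc1: "facet_coordinate K1 F g1 c1"
    using facet_coordinate_exists[OF cell_simplex[OF assms(1)] assms(4)] by blast
  obtain g2 c2 where gc2: "facet_coordinate K2 F g2 c2"
    using facet_coordinate_exists[OF cell_simplex[OF assms(2)] assms(5)] by blast
  obtain g3 c3 where gc3: "facet_coordinate K3 F g3 c3"
    using facet_coordinate_exists[OF cell_simplex[OF assms(3)] assms(6)] by blast
  obtain s where s: "s < 0" "g2 = s *\<^sub>R g1"
    using facet_coordinate_opposite[OF _ _ _ _ _ gc1 gc2] assms by blast
  obtain t where t: "t < 0" "g3 = t *\<^sub>R g1"
    using facet_coordinate_opposite[OF _ _ _ _ _ gc1 gc3] assms by blast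
  obtain u where u: "u < 0" "g3 = u *\<^sub>R g2"
    using facet_coordinate_opposite[OF _ _ _ _ _ gc2 gc3] assms \<open>K2 \<noteq> K3\<close> by blast
  have "t *\<^sub>R g1 = (u * s) *\<^sub>R g1" using s(2) t(2) u(2) by (metis scaleR_scaleR)
  moreover have "g1 \<noteq> 0" by (rule facet_coordinateD(1)[OF gc1])
  ultimately have "t = u * s" using scaleR_cancel_right by blast
  then show False using s t u mult_neg_neg[of u s] by linarith
qed

text \<open>The two cells fill the opposite halves of a small ball around a relatively interior
  point of \<open>F\<close>, which is thus interior to the closure of \<Omega>, hence in \<Omega>
  and off the frontier.\<close>

lemma shared_facet_not_boundary:
  assumes K: "K \<in> \<T>" "K' \<in> \<T>" "K \<noteq> K'" and F: "F facet_of K" "F facet_of K'"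
  shows "F \<notin> boundary_faces \<Omega> \<T>"
proof
  assume bd: "F \<in> boundary_faces \<Omega> \<T>"
  obtain g c where gc: "facet_coordinate K F g c"
    using facet_coordinate_exists[OF cell_simplex[OF K(1)] F(1)] by blast
  obtain g' c' where gc': "facet_coordinate K' F g' c'"
    using facet_coordinate_exists[OF cell_simplex[OF K(2)] F(2)] by blast
  obtain t where t: "t < 0" "g' = t *\<^sub>R g" "c' = t * c"
    using facet_coordinate_opposite[OF K F gc gc'] by blast
  obtain x where x: "x \<in> rel_interior F" using rel_interior_facet_nonempty[OF F(1)] by blast
  obtain r where r: "r > 0" "K \<inter> ball x r = {y \<in> ball x r. 0 \<le> g \<bullet> y + c}"
    using facet_coordinateD(3)[OF gc x] by blast
  obtain r' where r': "r' > 0" "K' \<inter> ball x r' = {y \<in> ball x r'. 0 \<le> g' \<bullet> y + c'}"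
    using facet_coordinateD(3)[OF gc' x] by blast
  have "ball x (min r r') \<subseteq> closure \<Omega>"
  proof
    fix y assume "y \<in> ball x (min r r')"
    then have y: "y \<in> ball x r" "y \<in> ball x r'" by auto
    have "g' \<bullet> y + c' = t * (g \<bullet> y + c)" using t by (simp add: distrib_left)
    then have "0 \<le> g \<bullet> y + c \<or> 0 \<le> g' \<bullet> y + c'"
      using t(1) by (metis linear mult_nonpos_nonpos less_imp_le)
    then have "y \<in> K \<union> K'" using y r(2) r'(2) by blast
    then show "y \<in> closure \<Omega>" using K Union_mesh by blast
  qed
  then have "x \<in> interior (closure \<Omega>)"
    unfolding mem_interior using r(1) r'(1) by (intro exI[of _ "min r r'"]) simp
  then have "x \<in> \<Omega>" by (simp add: interior_closure_domain)
  moreover have "x \<in> frontier \<Omega>"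
    using x bd rel_interior_subset by (auto simp: boundary_faces_def)
  ultimately show False using open_domain by (simp add: frontier_def interior_open)
qed

text \<open>Near a relatively interior point of \<open>F\<close> the cell \<open>K\<close> is all
  there is of the mesh, so \<Omega> is locally the half-space in which the coordinate is positive.
  The rest of the proof secures the uniqueness that \<open>THE\<close> demands.\<close>

lemma outward_normal_boundary_face:
  assumes K: "K \<in> \<T>" and F: "F facet_of K" "F \<in> boundary_faces \<Omega> \<T>"
    and gc: "facet_coordinate K F g c"
  shows "outward_normal \<Omega> F = - (g /\<^sub>R norm g)"
proof -
  let ?\<nu> = "- (g /\<^sub>R norm g)"
  have g0: "g \<noteq> 0" by (rule facet_coordinateD(1)[OF gc])
  have loc: "\<exists>r>0. \<Omega> \<inter> ball x r = {y \<in> ball x r. ?\<nu> \<bullet> (y - x) < 0}" if x: "x \<in> rel_interior F" for x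
  proof -
    obtain r1 where r1: "r1 > 0" "K \<inter> ball x r1 = {y \<in> ball x r1. 0 \<le> g \<bullet> y + c}"
      using facet_coordinateD(3)[OF gc x] by blast
    \<comment> \<open>Another cell through \<open>x\<close> would have \<open>F\<close> as a facet
      as well, and a shared facet is no boundary face.\<close>
    have "x \<notin> K'" if "K' \<in> \<T> - {K}" for K'
      using facet_Int_cell(2)[of K K' F x] shared_facet_not_boundary[of K K' F] K F x that by blast
    then have "x \<in> - \<Union>(\<T> - {K})" by blast
    moreover have "closed (\<Union>(\<T> - {K}))"
      using finite_mesh cell_closed by (intro closed_Union) auto
    ultimately obtain r2 where r2: "r2 > 0" "ball x r2 \<subseteq> - \<Union>(\<T> - {K})"
      using open_contains_ball open_Compl by metis
    define r where "r = min r1 r2"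
    have "r > 0" using r1 r2 by (simp add: r_def)
    have sub: "ball x r \<subseteq> ball x r1" "ball x r \<subseteq> ball x r2" by (auto simp: r_def)
    have "closure \<Omega> \<inter> ball x r = K \<inter> ball x r"
      using Union_mesh K r2(2) sub by blast
    also have "\<dots> = {y \<in> ball x r1. 0 \<le> g \<bullet> y + c} \<inter> ball x r"
      unfolding r1(2)[symmetric] using sub by blast
    also have "\<dots> = {y. g \<bullet> y \<ge> - c} \<inter> ball x r"
      using sub by (auto simp: r_def)
    \<comment> \<open>Taking interiors leads from the closure back to \<Omega> and makes the
      inequality strict.\<close>
    finally have "interior (closure \<Omega>) \<inter> ball x r = interior {y. g \<bullet> y \<ge> - c} \<inter> ball x r"
      by (metis interior_Int interior_open open_ball)
    then have "\<Omega> \<inter> ball x r = {y. g \<bullet> y > - c} \<inter> ball x r"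
      using g0 by (simp add: interior_closure_domain interior_halfspace_ge)
    moreover have "g \<bullet> x + c = 0"
      using x rel_interior_subset facet_coordinateD(4)[OF gc] by blast
    then have "g \<bullet> y > - c \<longleftrightarrow> ?\<nu> \<bullet> (y - x) < 0" for y
    proof -
      have "?\<nu> \<bullet> (y - x) = - (g \<bullet> y + c) / norm g"
      proof -
        have "g \<bullet> x = - c" using \<open>g \<bullet> x + c = 0\<close> by linarith
        then show ?thesis by (simp add: inner_diff_right divide_inverse algebra_simps)
      qed
      then show ?thesis using g0 by (auto simp: divide_less_0_iff)
    qed
    ultimately show ?thesis using \<open>r > 0\<close> by (intro exI[of _ r]) auto
  qed
  show ?thesis
    unfolding outward_normal_def
  proof (rule the_equality)
    show "norm ?\<nu> = 1 \<and> (\<forall>x\<in>rel_interior F. \<exists>r>0. \<Omega> \<inter> ball x r = {y \<in> ball x r. ?\<nu> \<bullet> (y - x) < 0})"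
      using loc g0 by simp
  next
    fix \<nu> assume \<nu>: "norm \<nu> = 1 \<and>
      (\<forall>x\<in>rel_interior F. \<exists>r>0. \<Omega> \<inter> ball x r = {y \<in> ball x r. \<nu> \<bullet> (y - x) < 0})"
    obtain x where x: "x \<in> rel_interior F" using rel_interior_facet_nonempty[OF F(1)] by blast
    obtain r where r: "r > 0" "\<Omega> \<inter> ball x r = {y \<in> ball x r. ?\<nu> \<bullet> (y - x) < 0}"
      using loc[OF x] by blast
    obtain r' where r': "r' > 0" "\<Omega> \<inter> ball x r' = {y \<in> ball x r'. \<nu> \<bullet> (y - x) < 0}"
      using \<nu> x by blast
    show "\<nu> = ?\<nu>"
    proof (rule ccontr)
      assume neq: "\<nu> \<noteq> ?\<nu>"
      \<comment> \<open>Distinct unit vectors have inner product below 1, so a step along their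
        difference enters the half-space of \<open>\<nu>\<close> and avoids that of
        \<open>?\<nu>\<close>.\<close>
      define z where "z = ?\<nu> - \<nu>"
      have z0: "norm z > 0" using neq by (simp add: z_def)
      have n1: "?\<nu> \<bullet> ?\<nu> = 1" "\<nu> \<bullet> \<nu> = 1"
        using \<nu> norm_eq_1[of ?\<nu>] norm_eq_1[of \<nu>] g0 by auto
      have "z \<bullet> z > 0" using z0 by simp
      then have less: "?\<nu> \<bullet> \<nu> < 1"
        using n1 unfolding z_def by (simp add: inner_diff_left inner_diff_right inner_commute)
      define s where "s = min r r' / (2 * norm z)"
      define y where "y = x + s *\<^sub>R z"
      have s: "s > 0" using r r' z0 by (simp add: s_def)
      have "norm (s *\<^sub>R z) = min r r' / 2" using r(1) r'(1) z0 by (simp add: s_def)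
      then have y: "y \<in> ball x r" "y \<in> ball x r'" using r(1) r'(1) by (auto simp: y_def dist_norm)
      have "\<nu> \<bullet> (y - x) = s * (?\<nu> \<bullet> \<nu> - 1)" "?\<nu> \<bullet> (y - x) = s * (1 - ?\<nu> \<bullet> \<nu>)"
        using n1 by (simp_all add: y_def z_def inner_diff_right inner_commute)
      then have "\<nu> \<bullet> (y - x) < 0" "\<not> ?\<nu> \<bullet> (y - x) < 0"
        using s less by (auto simp: mult_less_0_iff)
      then show False using y r(2) r'(2) by blast
    qed
  qed
qed

end

section \<open>Divergence of affine fields\<close>

lemma P1_add: "P1 p \<Longrightarrow> P1 q \<Longrightarrow> P1 (\<lambda>x. p x + q x)"
proof -
  assume "P1 p" "P1 q"
  then obtain l b m d where "linear l" "p = (\<lambda>x. l x + b)" "linear m" "q = (\<lambda>x. m x + d)"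
    by (auto simp: P1_def)
  then show ?thesis
    unfolding P1_def by (intro exI[of _ "\<lambda>x. l x + m x"] exI[of _ "b + d"]) (auto simp: linear_compose_add)
qed

lemma P1_linear_compose: "P1 p \<Longrightarrow> linear h \<Longrightarrow> P1 (\<lambda>x. h (p x))"
proof -
  assume "P1 p" and h: "linear h"
  then obtain l b where l: "linear l" "p = (\<lambda>x. l x + b)"
    by (auto simp: P1_def)
  have "linear (\<lambda>x. h (l x))"
    using linear_compose[OF l(1) h] by (simp add: o_def)
  then show ?thesis
    unfolding P1_def by (intro exI[of _ "\<lambda>x. h (l x)"] exI[of _ "h b"]) (simp add: l linear_add[OF h])
qed

lemma P1_scaleR: "P1 p \<Longrightarrow> P1 (\<lambda>x. a *\<^sub>R p x)"
  by (rule P1_linear_compose) (simp_all add: linear_scale_self)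

lemma P1_diff: "P1 p \<Longrightarrow> P1 q \<Longrightarrow> P1 (\<lambda>x. p x - q x)"
  using P1_add[of p "\<lambda>x. (- 1) *\<^sub>R q x"] P1_scaleR[of q "- 1"] by simp

lemma P1_const: "P1 (\<lambda>x. b)"
  unfolding P1_def by (intro exI[of _ "\<lambda>x. 0"] exI[of _ b]) (simp add: linear_zero)

lemma P1_inner_scaleR: "P1 (\<lambda>x. (g \<bullet> x + c) *\<^sub>R w)"
  by (rule P1_linear_compose[OF P1_inner]) (simp add: linearI scaleR_add_left)

section \<open>Uniqueness of affine representatives\<close>

lemma P1_eq_of_eq_on_open:
  fixes p q :: "'a::euclidean_space \<Rightarrow> 'b::real_vector"
  assumes "P1 p" "P1 q" "open U" "U \<noteq> {}" and eq: "\<And>x. x \<in> U \<Longrightarrow> p x = q x"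
  shows "p = q"
proof
  fix y
  obtain l b where l: "linear l" "\<And>x. p x - q x = l x + b"
    using P1_diff[OF assms(1,2)] by (auto simp: P1_def fun_eq_iff)
  obtain x r where x: "x \<in> U" and r: "r > 0" "ball x r \<subseteq> U"
    using assms(3,4) open_contains_ball by blast
  \<comment> \<open>The direction from \<open>x\<close> to \<open>y\<close> is shrunk until it stays
    in the ball; the \<open>+ 1\<close> covers the case \<open>y = x\<close>.\<close>
  define s where "s = r / (2 * (norm (y - x) + 1))"
  have s: "s > 0" using r by (simp add: s_def add_nonneg_pos)
  have "norm (s *\<^sub>R (y - x)) = (r / 2) * (norm (y - x) / (norm (y - x) + 1))"
    using r by (simp add: s_def)
  also have "\<dots> \<le> r / 2 * 1"
    using r by (intro mult_left_mono) (auto simp: divide_le_eq_1 add_nonneg_pos)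
  finally have "x + s *\<^sub>R (y - x) \<in> U"
    using r by (intro subsetD[OF r(2)]) (simp add: dist_norm)
  then have "l (x + s *\<^sub>R (y - x)) + b = 0" "l x + b = 0"
    using eq x l(2) by (metis diff_self)+
  moreover have "l (x + s *\<^sub>R (y - x)) = l x + s *\<^sub>R l (y - x)"
    by (simp only: linear_add[OF l(1)] linear_cmul[OF l(1)])
  ultimately have "s *\<^sub>R l (y - x) = 0"
    by (metis add.assoc add.commute add_cancel_right_left)
  then have "l (y - x) = 0" using s by simp
  then have "l y + b = 0"
    using \<open>l x + b = 0\<close> by (simp add: linear_diff[OF l(1)])
  then show "p y = q y" using l(2)[of y] by simp
qed

text \<open>In the interior of \<open>K\<close> the two continuous functions differ on an open null
  set, which is empty. This makes \<open>local_poly\<close> well defined.\<close>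

lemma P1_on_unique:
  fixes p q :: "'a::euclidean_space \<Rightarrow> 'b::euclidean_space"
  assumes p: "P1_on K v p" and q: "P1_on K v q" and K: "interior K \<noteq> {}"
  shows "p = q"
proof (rule P1_eq_of_eq_on_open)
  show P: "P1 p" "P1 q" using p q by (auto simp: P1_on_def)
  show "open (interior K)" "interior K \<noteq> {}" using K by auto
  have "AE x in lebesgue. x \<in> K \<longrightarrow> p x = q x"
    using p q unfolding P1_on_def by (auto elim: AE_mp)
  then obtain N where N: "N \<in> null_sets lebesgue" "{x. \<not> (x \<in> K \<longrightarrow> p x = q x)} \<subseteq> N"
    by (auto simp: eventually_ae_filter)
  define W where "W = interior K \<inter> {x. p x \<noteq> q x}"
  have "open W"
    unfolding W_def by (intro open_Int open_interior open_Collect_neq P1_continuous_on P)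
  moreover have "W \<subseteq> N" using N(2) interior_subset[of K] by (auto simp: W_def)
  then have "negligible W"
    using N(1) negligible_iff_null_sets negligible_subset by blast
  ultimately have "W = {}" using open_not_negligible by blast
  then show "p x = q x" if "x \<in> interior K" for x using that by (auto simp: W_def)
qed

lemma divergence_affine:
  assumes "linear l"
  shows "divergence (\<lambda>x. l x + b) y = (\<Sum>i\<in>UNIV. l (axis i 1) $ i)"
proof -
  have "((\<lambda>x. l x + b) has_derivative l) (at y)"
    using has_derivative_add[OF linear_imp_has_derivative[OF assms] has_derivative_const] by simp
  then have "frechet_derivative (\<lambda>x. l x + b) (at y) = l"
    by (rule frechet_derivative_at[symmetric])
  then show ?thesis
    by (simp add: divergence_def jacobian_def trace_def matrix_def)
qed

lemma divergence_P1_eq: "P1 p \<Longrightarrow> divergence p x = divergence p y"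
  unfolding P1_def by (auto simp: divergence_affine)

lemma divergence_add:
  assumes "P1 p" "P1 q"
  shows "divergence (\<lambda>x. p x + q x) y = divergence p y + divergence q y"
proof -
  obtain l b m d where l: "linear l" "p = (\<lambda>x. l x + b)" and m: "linear m" "q = (\<lambda>x. m x + d)"
    using assms by (auto simp: P1_def)
  have "(\<lambda>x. p x + q x) = (\<lambda>x. (l x + m x) + (b + d))" by (auto simp: l m)
  then show ?thesis
    using divergence_affine[OF linear_compose_add[OF l(1) m(1)], of "b + d" y]
    by (simp add: l m divergence_affine sum.distrib)
qed

lemma divergence_scaleR:
  assumes "P1 p"
  shows "divergence (\<lambda>x. a *\<^sub>R p x) y = a * divergence p y"
proof -
  obtain l b where l: "linear l" "p = (\<lambda>x. l x + b)"
    using assms by (auto simp: P1_def)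
  have "linear (\<lambda>x. a *\<^sub>R l x)"
    using linear_compose_scale_right[OF l(1)] .
  from divergence_affine[OF this, of "a *\<^sub>R b" y] show ?thesis
    by (simp add: l divergence_affine scaleR_add_right sum_distrib_left)
qed

lemma divergence_inner_scaleR: "divergence (\<lambda>x. (g \<bullet> x + c) *\<^sub>R w) y = g \<bullet> w"
proof -
  have "linear (\<lambda>x. (g \<bullet> x) *\<^sub>R w)"
    by (intro linearI) (simp_all add: inner_add_right scaleR_add_left)
  from divergence_affine[OF this, of "c *\<^sub>R w" y] show ?thesis
    by (simp add: scaleR_add_left inner_axis inner_vec_def[of g w])
qed

lemma divergence_zero: "divergence (\<lambda>x. 0) y = 0"
  using divergence_inner_scaleR[of 0 0 0 y] by simp

section \<open>Dual graph and piecewise functions\<close>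

context simplicial_domain
begin

text \<open>
  Cells in and outside \<open>\<A>\<close> that share no facet meet in codimension at least two, and a generic
  segment inside \<open>\<Omega>\<close> misses these intersections.
\<close>

lemma dual_graph_connected:
  assumes A: "\<A> \<subseteq> \<T>" "\<A> \<noteq> {}" "\<A> \<noteq> \<T>"
  shows "\<exists>K\<in>\<A>. \<exists>K'\<in>\<T> - \<A>. \<exists>F. F facet_of K \<and> F facet_of K'"
proof (rule ccontr)
  assume no: "\<not> ?thesis"
  have small: "aff_dim (K \<inter> K') \<le> int CARD('n) - 2" if K: "K \<in> \<A>" "K' \<in> \<T> - \<A>" for K K'
  proof (rule ccontr)
    assume large: "\<not> ?thesis"
    have KT: "K \<in> \<T>" "K' \<in> \<T>" "K \<noteq> K'" using K A by auto
    have "aff_dim (K \<inter> K') < CARD('n)"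
      using face_of_aff_dim_lt[OF cell_convex[OF KT(1)] cell_Int_face[OF KT(1,2)] cell_Int_neq[OF KT]]
        cell_aff_dim[OF KT(1)] by simp
    with large have dim: "aff_dim (K \<inter> K') = int CARD('n) - 1" by linarith
    moreover have "0 < CARD('n)" by simp
    ultimately have "0 \<le> aff_dim (K \<inter> K')" by linarith
    then have ne: "K \<inter> K' \<noteq> {}" by (auto simp: aff_dim_empty[symmetric])
    have "K \<inter> K' facet_of K"
      using cell_Int_face[OF KT(1,2)] ne dim cell_aff_dim[OF KT(1)] by (simp add: facet_of_def)
    moreover have "K \<inter> K' facet_of K'"
      using cell_Int_face[OF KT(2,1)] ne dim cell_aff_dim[OF KT(2)] by (simp add: facet_of_def Int_commute)
    ultimately show False using no K by blast
  qed
  define UA UB where "UA = \<Union>\<A>" and "UB = \<Union>(\<T> - \<A>)"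
  have fin: "finite \<A>" "finite (\<T> - \<A>)"
    using A(1) finite_mesh finite_subset by auto
  have closed: "closed UA" "closed UB"
    unfolding UA_def UB_def using fin A(1) cell_closed by (auto intro!: closed_Union)
  have cover: "\<Omega> \<subseteq> UA \<union> UB"
  proof
    fix x assume "x \<in> \<Omega>"
    then obtain K where "K \<in> \<T>" "x \<in> K" using Union_mesh closure_subset[of \<Omega>] by blast
    then show "x \<in> UA \<union> UB" by (cases "K \<in> \<A>") (auto simp: UA_def UB_def)
  qed
  have meets: "\<Omega> \<inter> K \<noteq> {}" if "K \<in> \<T>" for K
  proof -
    have "interior K \<subseteq> interior (closure \<Omega>)"
      using that Union_mesh by (intro interior_mono) blast
    then show ?thesis
      using interior_cell_nonempty[OF that] interior_subset[of K] interior_closure_domain by auto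
  qed
  \<comment> \<open>Two closed sets that cover the connected \<Omega> and both meet it have a common
    point in \<Omega>; around it the segment is placed.\<close>
  have "\<Omega> \<inter> UA \<noteq> {}" using meets A by (auto simp: UA_def)
  moreover have "\<Omega> \<inter> UB \<noteq> {}" using meets A by (auto simp: UB_def)
  moreover have "connected \<Omega>" using domain by (simp add: polyhedral_lipschitz_domain_def)
  ultimately obtain x where x: "x \<in> \<Omega>" "x \<in> UA" "x \<in> UB"
    using closed cover unfolding connected_closed by blast
  obtain r where r: "r > 0" "ball x r \<subseteq> \<Omega>"
    using x(1) open_domain open_contains_ball by blast
  obtain K where K: "K \<in> \<A>" "x \<in> K" using x(2) by (auto simp: UA_def)
  obtain K' where K': "K' \<in> \<T> - \<A>" "x \<in> K'" using x(3) by (auto simp: UB_def)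
  have near: "interior L \<inter> ball x r \<noteq> {}" if "L \<in> \<T>" "x \<in> L" for L
  proof -
    have "x \<in> closure (interior L)"
      using that convex_closure_interior[OF cell_convex interior_cell_nonempty] cell_closed by auto
    then show ?thesis
      using r(1) closure_iff_nhds_not_empty[of x "interior L"] by (metis centre_in_ball open_ball order_refl)
  qed
  obtain p where p: "p \<in> interior K" "p \<in> ball x r" using near[of K] K A by blast
  have pB: "p \<notin> UB"
    using p(1) interior_cell_disjoint[of K] K A by (auto simp: UB_def)
  \<comment> \<open>\<open>N\<close> contains every line from \<open>p\<close> through a point of a
    bad intersection. Adding \<open>p\<close> raises the dimension by at most one, so each hull has
    empty interior and \<open>q\<close> can be chosen outside of \<open>N\<close>.\<close>
  define N where "N = (\<Union>(L, L')\<in>\<A> \<times> (\<T> - \<A>). affine hull (insert p (L \<inter> L')))"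
  have "negligible N"
    unfolding N_def
  proof (rule negligible_Union)
    show "finite ((\<lambda>(L, L'). affine hull (insert p (L \<inter> L'))) ` (\<A> \<times> (\<T> - \<A>)))" using fin by simp
    fix S assume "S \<in> (\<lambda>(L, L'). affine hull (insert p (L \<inter> L'))) ` (\<A> \<times> (\<T> - \<A>))"
    then obtain L L' where s: "S = affine hull (insert p (L \<inter> L'))" "L \<in> \<A>" "L' \<in> \<T> - \<A>" by auto
    have "aff_dim (insert p (L \<inter> L')) \<le> int CARD('n) - 1"
      using small[OF s(2,3)] by (simp add: aff_dim_insert)
    then have "interior (affine hull (insert p (L \<inter> L'))) = {}"
      using aff_dim_nonempty_interior[of "affine hull (insert p (L \<inter> L'))"] by fastforce
    then show "negligible S"
      using negligible_convex_interior[of "affine hull (insert p (L \<inter> L'))"]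
      by (simp add: s(1) affine_imp_convex affine_affine_hull)
  qed
  moreover have "open (interior K' \<inter> ball x r)" "interior K' \<inter> ball x r \<noteq> {}"
    using near[of K'] K' by auto
  ultimately obtain q where q: "q \<in> interior K'" "q \<in> ball x r" "q \<notin> N"
    using open_not_negligible negligible_subset by (metis Int_iff subsetI)
  have "closed_segment p q \<subseteq> ball x r"
    using p q by (simp add: closed_segment_subset)
  then have seg: "closed_segment p q \<subseteq> UA \<union> UB" using r(2) cover by blast
  have "p \<in> UA" "q \<in> UB"
    using p q K K' interior_subset[of K] interior_subset[of K'] by (auto simp: UA_def UB_def)
  then have "closed_segment p q \<inter> UA \<noteq> {}" "closed_segment p q \<inter> UB \<noteq> {}" by auto
  with seg closed connected_segment(1)[of p q]
  obtain z where z: "z \<in> closed_segment p q" "z \<in> UA" "z \<in> UB"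
    unfolding connected_closed by blast
  obtain L where L: "L \<in> \<A>" "z \<in> L" using z(2) by (auto simp: UA_def)
  obtain L' where L': "L' \<in> \<T> - \<A>" "z \<in> L'" using z(3) by (auto simp: UB_def)
  obtain t where t: "z = (1 - t) *\<^sub>R p + t *\<^sub>R q"
    using z(1) by (auto simp: closed_segment_def)
  \<comment> \<open>The crossing point \<open>z\<close> differs from \<open>p\<close>, so
    \<open>q\<close> is on the line through \<open>p\<close> and \<open>z\<close>, which lies in
    \<open>N\<close>.\<close>
  have "t \<noteq> 0" using t z(3) pB by auto
  have "t *\<^sub>R q = z - (1 - t) *\<^sub>R p" using t by simp
  then have "q = (1 / t) *\<^sub>R (z - (1 - t) *\<^sub>R p)"
    using \<open>t \<noteq> 0\<close> by (metis divide_self_if scaleR_one scaleR_scaleR times_divide_eq_left mult_1)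
  also have "\<dots> = (1 / t) *\<^sub>R z + (1 - 1 / t) *\<^sub>R p"
    using \<open>t \<noteq> 0\<close> by (simp add: scaleR_diff_right diff_divide_distrib scaleR_diff_left)
  also have "\<dots> \<in> affine hull (insert p (L \<inter> L'))"
    using L L' by (intro mem_affine[OF affine_affine_hull]) (auto intro: hull_inc)
  finally have "q \<in> N"
    unfolding N_def using L L' by (intro UN_I[of "(L, L')"]) auto
  then show False using q(3) by simp
qed

text \<open>The shape is that of \<open>broken_div\<close> and the codomain is arbitrary, so that
  fields and their elementwise divergences obey the same facts.\<close>

definition piecewise :: "((real^'n) set \<Rightarrow> real^'n \<Rightarrow> 'b::euclidean_space) \<Rightarrow> real^'n \<Rightarrow> 'b" where
  "piecewise f x = (\<Sum>K | K \<in> \<T> \<and> x \<in> interior K. f K x)"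

lemma piecewise_interior:
  assumes "K \<in> \<T>" "x \<in> interior K"
  shows "piecewise f x = f K x"
proof -
  have "{K'. K' \<in> \<T> \<and> x \<in> interior K'} = {K}"
  proof (intro equalityI subsetI)
    fix K' assume "K' \<in> {K'. K' \<in> \<T> \<and> x \<in> interior K'}"
    then have "K' \<in> \<T>" "x \<in> K'" using interior_subset[of K'] by auto
    then show "K' \<in> {K}"
      using interior_cell_disjoint[OF assms(1), of K'] assms(2) by blast
  qed (use assms in simp)
  then show ?thesis by (simp add: piecewise_def)
qed

lemma AE_piecewise:
  assumes "K \<in> \<T>"
  shows "AE x\<in>K in lebesgue. piecewise f x = f K x"
proof (rule AE_I')
  show "frontier K \<in> null_sets lebesgue"
    using negligible_convex_frontier[OF cell_convex[OF assms]] by (simp add: negligible_iff_null_sets)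
  show "{x \<in> space lebesgue. \<not> (x \<in> K \<longrightarrow> piecewise f x = f K x)} \<subseteq> frontier K"
  proof
    fix x assume "x \<in> {x \<in> space lebesgue. \<not> (x \<in> K \<longrightarrow> piecewise f x = f K x)}"
    then have "x \<in> K" "x \<notin> interior K" using piecewise_interior[OF assms, of x f] by auto
    then show "x \<in> frontier K" using closure_subset[of K] by (auto simp: frontier_def)
  qed
qed

lemma local_poly_unique:
  fixes v :: "real^'n \<Rightarrow> 'b::euclidean_space"
  assumes "K \<in> \<T>" "P1_on K v p"
  shows "local_poly v K = p"
  unfolding local_poly_def
  by (rule the_equality) (rule assms(2), rule P1_on_unique[OF _ assms(2) interior_cell_nonempty[OF assms(1)]])

lemma P1_on_piecewise:
  assumes "K \<in> \<T>" "P1 (f K)"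
  shows "P1_on K (piecewise f) (f K)"
  using assms AE_piecewise by (simp add: P1_on_def)

text \<open>Each piece is bounded on the compact closure of \<Omega>, and the sum of the bounds
  dominates the function on a set of finite measure.\<close>

lemma L2_on_piecewise:
  fixes f :: "(real^'n) set \<Rightarrow> real^'n \<Rightarrow> 'b::euclidean_space"
  assumes cont: "\<And>K. K \<in> \<T> \<Longrightarrow> continuous_on UNIV (f K)"
  shows "L2_on \<Omega> (piecewise f)"
proof -
  have eq: "piecewise f = (\<lambda>x. \<Sum>K\<in>\<T>. indicator (interior K) x *\<^sub>R f K x)"
  proof
    fix x
    have "piecewise f x = (\<Sum>K\<in>\<T>. if x \<in> interior K then f K x else 0)"
      unfolding piecewise_def using finite_mesh by (simp add: sum.inter_filter)
    also have "\<dots> = (\<Sum>K\<in>\<T>. indicator (interior K) x *\<^sub>R f K x)"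
      by (intro sum.cong) (auto simp: indicator_def)
    finally show "piecewise f x = (\<Sum>K\<in>\<T>. indicator (interior K) x *\<^sub>R f K x)" .
  qed
  have "piecewise f \<in> borel_measurable borel"
    unfolding eq
  proof (rule borel_measurable_sum)
    fix K assume "K \<in> \<T>"
    then have [measurable]: "f K \<in> borel_measurable borel"
      by (rule borel_measurable_continuous_onI[OF cont])
    show "(\<lambda>x. indicator (interior K) x *\<^sub>R f K x) \<in> borel_measurable borel"
      by measurable
  qed
  then have meas [measurable]: "piecewise f \<in> borel_measurable lebesgue"
    by (intro measurable_completion) simp
  have bdd: "bounded \<Omega>" using domain by (simp add: polyhedral_lipschitz_domain_def)
  have "\<forall>K\<in>\<T>. \<exists>M. \<forall>x\<in>\<Omega>. norm (f K x) \<le> M"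
  proof
    fix K assume that: "K \<in> \<T>"
    have "compact (f K ` closure \<Omega>)"
      using bdd cont[OF that] by (intro compact_continuous_image continuous_on_subset[OF cont[OF that]]) auto
    from compact_imp_bounded[OF this] obtain M where "\<forall>y\<in>f K ` closure \<Omega>. norm y \<le> M"
      unfolding bounded_iff by blast
    then show "\<exists>M. \<forall>x\<in>\<Omega>. norm (f K x) \<le> M"
      using closure_subset[of \<Omega>] by blast
  qed
  from bchoice[OF this] obtain M where M: "\<And>K x. K \<in> \<T> \<Longrightarrow> x \<in> \<Omega> \<Longrightarrow> norm (f K x) \<le> M K"
    by blast
  have bound: "norm ((norm (piecewise f x))\<^sup>2) \<le> (\<Sum>K\<in>\<T>. M K)\<^sup>2" if "x \<in> \<Omega>" for x
  proof -
    have "norm (piecewise f x) \<le> (\<Sum>K\<in>\<T>. norm (indicator (interior K) x *\<^sub>R f K x))"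
      unfolding eq by (rule norm_sum)
    also have "\<dots> \<le> (\<Sum>K\<in>\<T>. M K)"
    proof (rule sum_mono)
      fix K assume "K \<in> \<T>"
      from M[OF this that] show "norm (indicator (interior K) x *\<^sub>R f K x) \<le> M K"
        using norm_ge_zero[of "f K x"] by (cases "x \<in> interior K") (simp, simp del: norm_ge_zero)
    qed
    finally show ?thesis by (simp add: power_mono)
  qed
  have sets: "\<Omega> \<in> sets lebesgue" using open_domain by auto
  have "emeasure lebesgue \<Omega> < \<infinity>"
    using lmeasurable_open[OF bdd open_domain] unfolding fmeasurable_def by blast
  then have "set_integrable lebesgue \<Omega> (\<lambda>x. (norm (piecewise f x))\<^sup>2)"
    unfolding set_integrable_def
    using sets bound by (intro integrableI_bounded_set_indicator[where B="(\<Sum>K\<in>\<T>. M K)\<^sup>2"]) auto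
  moreover have "set_borel_measurable lebesgue \<Omega> (piecewise f)"
    unfolding set_borel_measurable_def using sets by measurable
  ultimately show ?thesis by (simp add: L2_on_def)
qed

end

section \<open>Fields with prescribed divergence\<close>

text \<open>The scalar Crouzeix--Raviart basis function of a facet times \<open>w\<close>,
  multiplied out into gradient and offset to match \<open>P1_inner_scaleR\<close> and
  \<open>divergence_inner_scaleR\<close>.\<close>

definition facet_bump :: "real^'n \<Rightarrow> real \<Rightarrow> real^'n \<Rightarrow> real^'n \<Rightarrow> real^'n" where
  "facet_bump g c w x = ((- real CARD('n) *\<^sub>R g) \<bullet> x + (1 - real CARD('n) * c)) *\<^sub>R w"

lemma P1_facet_bump: "P1 (facet_bump g c w)"
  unfolding facet_bump_def [abs_def] by (rule P1_inner_scaleR)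

lemma divergence_facet_bump:
  fixes g w :: "real^'n"
  shows "divergence (facet_bump g c w) y = - CARD('n) * (g \<bullet> w)"
  unfolding facet_bump_def [abs_def] divergence_inner_scaleR by simp

lemma facet_bump_centroid:
  assumes "facet_coordinate K F g c" and "F' facet_of K"
  shows "facet_bump g c w (vertex_centroid F') = (if F' = F then w else 0)"
proof -
  have "facet_bump g c w x = (1 - CARD('a) * (g \<bullet> x + c)) *\<^sub>R w" for x
    by (simp add: facet_bump_def algebra_simps)
  then show ?thesis
    by (simp add: facet_coordinate_centroid[OF assms])
qed

section \<open>Centroid form of the Crouzeix--Raviart constraints\<close>

context simplicial_domain
begin

text \<open>The constraints of \<open>CR_space\<close> with each facet mean replaced by a centroid
  value. They are imposed on the family of affine pieces, where they are linear and pointwise, so no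
  almost-everywhere representatives occur.\<close>

definition admissible ::
    "(real^'n) set \<Rightarrow> (real^'n) set \<Rightarrow> (real^'n) set \<Rightarrow> ((real^'n) set \<Rightarrow> real^'n \<Rightarrow> real^'n) \<Rightarrow> bool" where
  "admissible \<Gamma>D \<Gamma>S \<Gamma>E P \<longleftrightarrow>
     (\<forall>K\<in>\<T>. P1 (P K)) \<and>
     (\<forall>K\<in>\<T>. \<forall>K'\<in>\<T>. \<forall>F. K \<noteq> K' \<and> F facet_of K \<and> F facet_of K' \<longrightarrow>
        P K (vertex_centroid F) = P K' (vertex_centroid F)) \<and>
     (\<forall>K\<in>\<T>. \<forall>F\<in>boundary_faces \<Omega> \<T>. F facet_of K \<longrightarrow>
        (face_in F \<Gamma>D \<longrightarrow> P K (vertex_centroid F) = 0) \<and>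
        (face_in F \<Gamma>S \<longrightarrow> P K (vertex_centroid F) \<bullet> outward_normal \<Omega> F = 0) \<and>
        (face_in F \<Gamma>E \<longrightarrow>
           P K (vertex_centroid F) -
             (P K (vertex_centroid F) \<bullet> outward_normal \<Omega> F) *\<^sub>R outward_normal \<Omega> F = 0))"

lemma admissibleD:
  assumes "admissible \<Gamma>D \<Gamma>S \<Gamma>E P" and "K \<in> \<T>"
  shows "P1 (P K)"
    and "K' \<in> \<T> \<Longrightarrow> K \<noteq> K' \<Longrightarrow> F facet_of K \<Longrightarrow> F facet_of K' \<Longrightarrow>
      P K (vertex_centroid F) = P K' (vertex_centroid F)"
    and "F \<in> boundary_faces \<Omega> \<T> \<Longrightarrow> F facet_of K \<Longrightarrow> face_in F \<Gamma>D \<Longrightarrow> P K (vertex_centroid F) = 0"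
    and "F \<in> boundary_faces \<Omega> \<T> \<Longrightarrow> F facet_of K \<Longrightarrow> face_in F \<Gamma>S \<Longrightarrow>
      P K (vertex_centroid F) \<bullet> outward_normal \<Omega> F = 0"
    and "F \<in> boundary_faces \<Omega> \<T> \<Longrightarrow> F facet_of K \<Longrightarrow> face_in F \<Gamma>E \<Longrightarrow>
      P K (vertex_centroid F) -
        (P K (vertex_centroid F) \<bullet> outward_normal \<Omega> F) *\<^sub>R outward_normal \<Omega> F = 0"
  using assms unfolding admissible_def by blast+

text \<open>The fields built below take only the values zero and unit normal at boundary centroids.
  A unit normal has zero tangential part and so meets the condition on \<open>\<Gamma>E\<close>;
  only \<open>\<Gamma>D\<close> and \<open>\<Gamma>S\<close> have to be excluded.\<close>

lemma admissible_unit_normalI: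
  assumes P1: "\<And>K. K \<in> \<T> \<Longrightarrow> P1 (P K)"
    and jump: "\<And>K K' F. K \<in> \<T> \<Longrightarrow> K' \<in> \<T> \<Longrightarrow> K \<noteq> K' \<Longrightarrow> F facet_of K \<Longrightarrow> F facet_of K' \<Longrightarrow>
        P K (vertex_centroid F) = P K' (vertex_centroid F)"
    and bd: "\<And>K F. K \<in> \<T> \<Longrightarrow> F \<in> boundary_faces \<Omega> \<T> \<Longrightarrow> F facet_of K \<Longrightarrow>
        P K (vertex_centroid F) = 0 \<or>
        P K (vertex_centroid F) = outward_normal \<Omega> F \<and> norm (outward_normal \<Omega> F) = 1 \<and>
          \<not> face_in F \<Gamma>D \<and> \<not> face_in F \<Gamma>S"
  shows "admissible \<Gamma>D \<Gamma>S \<Gamma>E P"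
proof -
  have "(face_in F \<Gamma>D \<longrightarrow> P K (vertex_centroid F) = 0) \<and>
      (face_in F \<Gamma>S \<longrightarrow> P K (vertex_centroid F) \<bullet> outward_normal \<Omega> F = 0) \<and>
      (face_in F \<Gamma>E \<longrightarrow> P K (vertex_centroid F) -
         (P K (vertex_centroid F) \<bullet> outward_normal \<Omega> F) *\<^sub>R outward_normal \<Omega> F = 0)"
    if "K \<in> \<T>" "F \<in> boundary_faces \<Omega> \<T>" "F facet_of K" for K F
    using bd[OF that] by (elim disjE conjE) (simp_all add: norm_eq_1)
  then show ?thesis
    unfolding admissible_def using P1 jump by blast
qed

lemma admissible_zero: "admissible \<Gamma>D \<Gamma>S \<Gamma>E (\<lambda>K x. 0)"
  by (rule admissible_unit_normalI) (auto simp: P1_const)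

lemma admissible_add:
  assumes P: "admissible \<Gamma>D \<Gamma>S \<Gamma>E P" and Q: "admissible \<Gamma>D \<Gamma>S \<Gamma>E Q"
  shows "admissible \<Gamma>D \<Gamma>S \<Gamma>E (\<lambda>K x. P K x + Q K x)"
  unfolding admissible_def
proof (intro conjI ballI allI impI; (elim conjE)?)
  fix K assume K: "K \<in> \<T>"
  show "P1 (\<lambda>x. P K x + Q K x)"
    by (intro P1_add admissibleD(1)[OF P K] admissibleD(1)[OF Q K])
  fix K' F assume K': "K' \<in> \<T>" "K \<noteq> K'" "F facet_of K" "F facet_of K'"
  show "P K (vertex_centroid F) + Q K (vertex_centroid F) = P K' (vertex_centroid F) + Q K' (vertex_centroid F)"
    by (simp only: admissibleD(2)[OF P K K'] admissibleD(2)[OF Q K K'])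
next
  fix K F assume K: "K \<in> \<T>" and F: "F \<in> boundary_faces \<Omega> \<T>" "F facet_of K"
  let ?x = "vertex_centroid F" and ?n = "outward_normal \<Omega> F"
  show "P K ?x + Q K ?x = 0" if "face_in F \<Gamma>D"
    using admissibleD(3)[OF P K F that] admissibleD(3)[OF Q K F that] by simp
  show "(P K ?x + Q K ?x) \<bullet> ?n = 0" if "face_in F \<Gamma>S"
    using admissibleD(4)[OF P K F that] admissibleD(4)[OF Q K F that] by (simp add: inner_add_left)
  show "P K ?x + Q K ?x - ((P K ?x + Q K ?x) \<bullet> ?n) *\<^sub>R ?n = 0" if "face_in F \<Gamma>E"
  proof -
    have "P K ?x + Q K ?x - ((P K ?x + Q K ?x) \<bullet> ?n) *\<^sub>R ?n
        = (P K ?x - (P K ?x \<bullet> ?n) *\<^sub>R ?n) + (Q K ?x - (Q K ?x \<bullet> ?n) *\<^sub>R ?n)"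
      by (simp add: inner_add_left scaleR_add_left)
    then show ?thesis
      by (simp only: admissibleD(5)[OF P K F that] admissibleD(5)[OF Q K F that] add_0_left)
  qed
qed

lemma admissible_scaleR:
  assumes P: "admissible \<Gamma>D \<Gamma>S \<Gamma>E P"
  shows "admissible \<Gamma>D \<Gamma>S \<Gamma>E (\<lambda>K x. a *\<^sub>R P K x)"
  unfolding admissible_def
proof (intro conjI ballI allI impI; (elim conjE)?)
  fix K assume K: "K \<in> \<T>"
  show "P1 (\<lambda>x. a *\<^sub>R P K x)"
    by (intro P1_scaleR admissibleD(1)[OF P K])
  fix K' F assume K': "K' \<in> \<T>" "K \<noteq> K'" "F facet_of K" "F facet_of K'"
  show "a *\<^sub>R P K (vertex_centroid F) = a *\<^sub>R P K' (vertex_centroid F)"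
    by (simp only: admissibleD(2)[OF P K K'])
next
  fix K F assume K: "K \<in> \<T>" and F: "F \<in> boundary_faces \<Omega> \<T>" "F facet_of K"
  let ?x = "vertex_centroid F" and ?n = "outward_normal \<Omega> F"
  show "a *\<^sub>R P K ?x = 0" if "face_in F \<Gamma>D"
    using admissibleD(3)[OF P K F that] by simp
  show "(a *\<^sub>R P K ?x) \<bullet> ?n = 0" if "face_in F \<Gamma>S"
    using admissibleD(4)[OF P K F that] by simp
  show "a *\<^sub>R P K ?x - ((a *\<^sub>R P K ?x) \<bullet> ?n) *\<^sub>R ?n = 0" if "face_in F \<Gamma>E"
  proof -
    have "a *\<^sub>R P K ?x - ((a *\<^sub>R P K ?x) \<bullet> ?n) *\<^sub>R ?n = a *\<^sub>R (P K ?x - (P K ?x \<bullet> ?n) *\<^sub>R ?n)"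
      by (simp only: inner_scaleR_left scaleR_diff_right scaleR_scaleR)
    then show ?thesis
      by (simp only: admissibleD(5)[OF P K F that] scaleR_zero_right)
  qed
qed

lemma local_poly_piecewise:
  assumes "K \<in> \<T>" "P1 (P K)"
  shows "local_poly (piecewise P) K = P K"
  using local_poly_unique P1_on_piecewise assms by blast

text \<open>Jumps, normal components and tangential parts of affine pieces are affine again, so each
  integral vanishes with the value at the centroid.\<close>

lemma admissible_imp_CR:
  assumes adm: "admissible \<Gamma>D \<Gamma>S \<Gamma>E P"
  shows "piecewise P \<in> CR_space \<Omega> \<T> \<Gamma>D \<Gamma>S \<Gamma>E"
proof -
  have P1: "P1 (P K)" if "K \<in> \<T>" for K by (rule admissibleD(1)[OF adm that])
  have lp: "local_poly (piecewise P) K = P K" if "K \<in> \<T>" for K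
    using local_poly_piecewise P1 that by blast
  have zero: "face_integral F h = 0" if "K \<in> \<T>" "F facet_of K" "P1 h" "h (vertex_centroid F) = 0"
    for K F and h :: "real^'n \<Rightarrow> 'c::euclidean_space"
    using face_integral_facet[OF cell_simplex[OF that(1)] that(2,3)] that(4) by simp
  show ?thesis
    unfolding CR_space_def mem_Collect_eq
  proof (intro conjI ballI allI impI; (elim conjE)?)
    show "L2_on \<Omega> (piecewise P)"
      by (intro L2_on_piecewise P1_continuous_on P1)
    show "\<exists>p. P1_on K (piecewise P) p" if "K \<in> \<T>" for K
      using P1_on_piecewise P1 that by blast
  next
    fix K K' F assume K: "K \<in> \<T>" "K' \<in> \<T>" "K \<noteq> K'" "F facet_of K" "F facet_of K'"
    have "P K (vertex_centroid F) = P K' (vertex_centroid F)"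
      by (rule admissibleD(2)[OF adm K])
    then have "P K (vertex_centroid F) - P K' (vertex_centroid F) = 0" by simp
    then show "face_integral F (\<lambda>x. local_poly (piecewise P) K x - local_poly (piecewise P) K' x) = 0"
      unfolding lp[OF K(1)] lp[OF K(2)] by (rule zero[OF K(1,4) P1_diff[OF P1[OF K(1)] P1[OF K(2)]]])
  next
    fix K F assume K: "K \<in> \<T>" "F \<in> boundary_faces \<Omega> \<T>" "F facet_of K"
    let ?x = "vertex_centroid F" and ?n = "outward_normal \<Omega> F"
    show "face_integral F (local_poly (piecewise P) K) = 0" if "face_in F \<Gamma>D"
    proof -
      have "P K ?x = 0" by (rule admissibleD(3)[OF adm K that])
      then show ?thesis
        unfolding lp[OF K(1)] by (rule zero[OF K(1,3) P1[OF K(1)]])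
    qed
    show "face_integral F (\<lambda>x. local_poly (piecewise P) K x \<bullet> ?n) = 0" if "face_in F \<Gamma>S"
    proof -
      have "P1 (\<lambda>x. P K x \<bullet> ?n)"
        by (rule P1_linear_compose[OF P1[OF K(1)]]) (simp add: linearI inner_add_left)
      moreover have "P K ?x \<bullet> ?n = 0" by (rule admissibleD(4)[OF adm K that])
      ultimately show ?thesis
        unfolding lp[OF K(1)] by (rule zero[OF K(1,3)])
    qed
    show "face_integral F (\<lambda>x. local_poly (piecewise P) K x -
        (local_poly (piecewise P) K x \<bullet> ?n) *\<^sub>R ?n) = 0" if "face_in F \<Gamma>E"
    proof -
      have "linear (\<lambda>y. y - (y \<bullet> ?n) *\<^sub>R ?n)"
        by (rule linearI) (simp_all add: inner_add_left scaleR_add_left scaleR_diff_right)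
      then have "P1 (\<lambda>x. P K x - (P K x \<bullet> ?n) *\<^sub>R ?n)"
        by (rule P1_linear_compose[OF P1[OF K(1)]])
      moreover have "P K ?x - (P K ?x \<bullet> ?n) *\<^sub>R ?n = 0"
        by (rule admissibleD(5)[OF adm K that])
      ultimately show ?thesis
        unfolding lp[OF K(1)] by (rule zero[OF K(1,3)])
    qed
  qed
qed

text \<open>The indicator function of one cell as a divergence. Evaluation at \<open>0\<close> is
  legitimate wherever \<open>K'\<close> lies, as an affine field has the same divergence
  everywhere.\<close>

definition has_unit_divergence where
  "has_unit_divergence \<Gamma>D \<Gamma>S \<Gamma>E K \<longleftrightarrow>
     (\<exists>P. admissible \<Gamma>D \<Gamma>S \<Gamma>E P \<and>
       (\<forall>K'\<in>\<T>. divergence (P K') 0 = (if K' = K then 1 else 0)))"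

text \<open>The bump of \<open>F\<close> on \<open>K\<close> alone, directed along the normal,
  works: \<open>F\<close> belongs to no other cell, and at the centroids of the remaining facets of
  \<open>K\<close> the bump vanishes, so no jump arises.\<close>

lemma has_unit_divergence_boundary:
  assumes K: "K \<in> \<T>" and F: "F facet_of K" "F \<in> boundary_faces \<Omega> \<T>"
    and nD: "\<not> face_in F \<Gamma>D" and nS: "\<not> face_in F \<Gamma>S"
  shows "has_unit_divergence \<Gamma>D \<Gamma>S \<Gamma>E K"
proof -
  obtain g c where gc: "facet_coordinate K F g c"
    using facet_coordinate_exists[OF cell_simplex[OF K] F(1)] by blast
  let ?n = "outward_normal \<Omega> F"
  have n: "?n = - (g /\<^sub>R norm g)"
    by (rule outward_normal_boundary_face[OF K F gc])
  have g0: "g \<noteq> 0" by (rule facet_coordinateD(1)[OF gc])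
  define P where "P L = (if L = K then facet_bump g c ?n else (\<lambda>x. 0))" for L
  have val: "P L (vertex_centroid F') = (if L = K \<and> F' = F then ?n else 0)" if "F' facet_of L" for L F'
    using that facet_bump_centroid[OF gc, of F' ?n] by (cases "L = K") (auto simp only: P_def if_True if_False simp_thms)
  have sole: "L = K" if "L \<in> \<T>" "F facet_of L" for L
    using shared_facet_not_boundary[OF K that(1) _ F(1) that(2)] F(2) by blast
  have "admissible \<Gamma>D \<Gamma>S \<Gamma>E P"
  proof (rule admissible_unit_normalI)
    show "P1 (P L)" for L by (simp add: P_def P1_facet_bump P1_const)
    show "P L (vertex_centroid F') = P L' (vertex_centroid F')"
      if "L \<in> \<T>" "L' \<in> \<T>" "L \<noteq> L'" "F' facet_of L" "F' facet_of L'" for L L' F'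
    proof -
      have "F' \<noteq> F" using sole[of L] sole[of L'] that by blast
      then show ?thesis by (simp only: val[OF that(4)] val[OF that(5)] simp_thms if_False)
    qed
    show "P L (vertex_centroid F') = 0 \<or>
        P L (vertex_centroid F') = outward_normal \<Omega> F' \<and> norm (outward_normal \<Omega> F') = 1 \<and>
          \<not> face_in F' \<Gamma>D \<and> \<not> face_in F' \<Gamma>S"
      if "L \<in> \<T>" "F' \<in> boundary_faces \<Omega> \<T>" "F' facet_of L" for L F'
    proof (cases "L = K \<and> F' = F")
      case True
      then have "P L (vertex_centroid F') = ?n" using val[OF that(3)] by simp
      moreover have "norm ?n = 1" using g0 by (simp add: n)
      ultimately show ?thesis using True nD nS by simp
    qed (simp only: val[OF that(3)] if_False simp_thms)
  qed
  \<comment> \<open>The divergence on \<open>K\<close> is \<open>CARD('n) * norm g\<close>, which is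
    nonzero and gets normalised.\<close>
  then have adm: "admissible \<Gamma>D \<Gamma>S \<Gamma>E (\<lambda>L x. (1 / divergence (P K) 0) *\<^sub>R P L x)"
    by (rule admissible_scaleR)
  have P1: "P1 (P L)" for L by (simp add: P_def P1_facet_bump P1_const)
  have "divergence (P K) 0 \<noteq> 0"
    using g0 by (simp add: P_def divergence_facet_bump n)
  then have "\<forall>L\<in>\<T>. divergence (\<lambda>x. (1 / divergence (P K) 0) *\<^sub>R P L x) 0 = (if L = K then 1 else 0)"
    unfolding divergence_scaleR[OF P1] by (simp add: P_def divergence_zero)
  then show ?thesis using adm unfolding has_unit_divergence_def by blast
qed

text \<open>The bump across \<open>F\<close> has divergence \<open>a\<close> on \<open>K\<close> and
  \<open>b\<close> on \<open>K'\<close>; subtracting \<open>a\<close> times the field for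
  \<open>K\<close> and dividing by \<open>b\<close> isolates \<open>K'\<close>.\<close>

lemma has_unit_divergence_neighbour:
  assumes K: "K \<in> \<T>" "K' \<in> \<T>" "K \<noteq> K'" and F: "F facet_of K" "F facet_of K'"
    and unit: "has_unit_divergence \<Gamma>D \<Gamma>S \<Gamma>E K"
  shows "has_unit_divergence \<Gamma>D \<Gamma>S \<Gamma>E K'"
proof -
  obtain g c where gc: "facet_coordinate K F g c"
    using facet_coordinate_exists[OF cell_simplex[OF K(1)] F(1)] by blast
  obtain g' c' where gc': "facet_coordinate K' F g' c'"
    using facet_coordinate_exists[OF cell_simplex[OF K(2)] F(2)] by blast
  obtain t where t: "t < 0" "g' = t *\<^sub>R g"
    using facet_coordinate_opposite[OF K F gc gc'] by blast
  have g0: "g \<noteq> 0" by (rule facet_coordinateD(1)[OF gc])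
  \<comment> \<open>Both bumps carry the same vector, so they agree at the centroid of
    \<open>F\<close>. The vector \<open>g\<close> is normal to \<open>F\<close> and thus
    transversal, seen from either cell.\<close>
  define Q where "Q L = (if L = K then facet_bump g c g else
      if L = K' then facet_bump g' c' g else (\<lambda>x. 0))" for L
  have P1Q: "P1 (Q L)" for L by (simp add: Q_def P1_facet_bump P1_const)
  have val: "Q L (vertex_centroid F') = (if (L = K \<or> L = K') \<and> F' = F then g else 0)" if "F' facet_of L" for L F'
    using that K(3) facet_bump_centroid[OF gc, of F' g] facet_bump_centroid[OF gc', of F' g]
    by (cases "L = K"; cases "L = K'") (auto simp only: Q_def if_True if_False simp_thms)
  have two: "L = K \<or> L = K'" if "L \<in> \<T>" "F facet_of L" for L
    using facet_at_most_two_cells[OF K(1,2) that(1) F that(2) K(3)] by blast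
  have admQ: "admissible \<Gamma>D \<Gamma>S \<Gamma>E Q"
  proof (rule admissible_unit_normalI)
    show "P1 (Q L)" for L by (rule P1Q)
    show "Q L (vertex_centroid F') = Q L' (vertex_centroid F')"
      if "L \<in> \<T>" "L' \<in> \<T>" "L \<noteq> L'" "F' facet_of L" "F' facet_of L'" for L L' F'
    proof (cases "F' = F")
      case True
      then have "L = K \<or> L = K'" "L' = K \<or> L' = K'" using two that by blast+
      then show ?thesis using True val[OF that(4)] val[OF that(5)] by simp
    qed (simp only: val[OF that(4)] val[OF that(5)] simp_thms if_False)
    show "Q L (vertex_centroid F') = 0 \<or>
        Q L (vertex_centroid F') = outward_normal \<Omega> F' \<and> norm (outward_normal \<Omega> F') = 1 \<and>
          \<not> face_in F' \<Gamma>D \<and> \<not> face_in F' \<Gamma>S"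
      if "L \<in> \<T>" "F' \<in> boundary_faces \<Omega> \<T>" "F' facet_of L" for L F'
    proof -
      have "F' \<noteq> F" using shared_facet_not_boundary[OF K F] that(2) by blast
      then show ?thesis by (simp only: val[OF that(3)] simp_thms if_False)
    qed
  qed
  obtain P where admP: "admissible \<Gamma>D \<Gamma>S \<Gamma>E P"
    and P: "\<forall>L\<in>\<T>. divergence (P L) 0 = (if L = K then 1 else 0)"
    using unit unfolding has_unit_divergence_def by blast
  have P1P: "P1 (P L)" if "L \<in> \<T>" for L by (rule admissibleD(1)[OF admP that])
  define a b where "a = divergence (Q K) 0" and "b = divergence (Q K') 0"
  \<comment> \<open>The gradient on \<open>K'\<close> is a nonzero multiple of \<open>g\<close>, so
    its product with \<open>g\<close> does not vanish.\<close>
  have b0: "b \<noteq> 0"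
    using g0 t K(3) by (simp add: b_def Q_def divergence_facet_bump)
  define R where "R L x = (1 / b) *\<^sub>R (Q L x + (- a) *\<^sub>R P L x)" for L x
  have "admissible \<Gamma>D \<Gamma>S \<Gamma>E R"
    unfolding R_def [abs_def] by (intro admissible_scaleR admissible_add admQ admP)
  moreover have "divergence (R L) 0 = (if L = K' then 1 else 0)" if L: "L \<in> \<T>" for L
  proof -
    have "divergence (R L) 0 = (1 / b) * (divergence (Q L) 0 + (- a) * divergence (P L) 0)"
      unfolding R_def [abs_def]
      by (simp only: divergence_scaleR[OF P1_add[OF P1Q P1_scaleR[OF P1P[OF L]]]]
          divergence_add[OF P1Q P1_scaleR[OF P1P[OF L]]] divergence_scaleR[OF P1P[OF L]])
    moreover have "divergence (Q L) 0 = (if L = K then a else if L = K' then b else 0)"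
      by (simp add: a_def b_def Q_def divergence_zero)
    ultimately show ?thesis
      using P L b0 K(3) by simp
  qed
  ultimately show ?thesis unfolding has_unit_divergence_def by blast
qed

text \<open>The set of cells whose indicator is attained contains the cell at \<open>F\<close> and
  is closed under passing to a neighbour; by \<open>dual_graph_connected\<close> it is the whole
  mesh. Superposition then yields arbitrary cell values.\<close>

lemma admissible_divergence_surj:
  assumes F: "F \<in> boundary_faces \<Omega> \<T>" and nD: "\<not> face_in F \<Gamma>D" and nS: "\<not> face_in F \<Gamma>S"
  shows "\<exists>P. admissible \<Gamma>D \<Gamma>S \<Gamma>E P \<and> (\<forall>K\<in>\<T>. divergence (P K) 0 = d K)"
proof -
  define \<A> where "\<A> = {K \<in> \<T>. has_unit_divergence \<Gamma>D \<Gamma>S \<Gamma>E K}"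
  obtain K0 where "K0 \<in> \<T>" "F facet_of K0" using F by (auto simp: boundary_faces_def)
  then have "K0 \<in> \<A>"
    using has_unit_divergence_boundary F nD nS by (simp add: \<A>_def)
  moreover have "\<A> \<subseteq> \<T>" by (auto simp: \<A>_def)
  moreover have "K' \<in> \<A>" if "K \<in> \<A>" "K' \<in> \<T>" "F' facet_of K" "F' facet_of K'" for K K' F'
    using has_unit_divergence_neighbour[of K K' F'] that by (cases "K = K'") (auto simp: \<A>_def)
  ultimately have "\<A> = \<T>"
    using dual_graph_connected[of \<A>] by blast
  then have unit: "has_unit_divergence \<Gamma>D \<Gamma>S \<Gamma>E K" if "K \<in> \<T>" for K
    using that unfolding \<A>_def by blast
  \<comment> \<open>Induction adds one cell at a time; prescribing zero off \<open>\<S>\<close>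
    keeps the values already reached intact.\<close>
  have "\<exists>P. admissible \<Gamma>D \<Gamma>S \<Gamma>E P \<and> (\<forall>K\<in>\<T>. divergence (P K) 0 = (if K \<in> \<S> then d K else 0))"
    if "finite \<S>" "\<S> \<subseteq> \<T>" for \<S>
    using that
  proof (induction rule: finite_induct)
    case empty
    then show ?case using admissible_zero divergence_zero by (intro exI[of _ "\<lambda>K x. 0"]) auto
  next
    case (insert L \<S>)
    then obtain P where P: "admissible \<Gamma>D \<Gamma>S \<Gamma>E P"
      "\<forall>K\<in>\<T>. divergence (P K) 0 = (if K \<in> \<S> then d K else 0)" by auto
    obtain Q where Q: "admissible \<Gamma>D \<Gamma>S \<Gamma>E Q"
      "\<forall>K\<in>\<T>. divergence (Q K) 0 = (if K = L then 1 else 0)"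
      using unit[of L] insert.prems unfolding has_unit_divergence_def by auto
    have P1: "P1 (P K)" "P1 (Q K)" if "K \<in> \<T>" for K
      using admissibleD(1) P(1) Q(1) that by blast+
    have "divergence (\<lambda>x. P K x + d L *\<^sub>R Q K x) 0 = (if K \<in> insert L \<S> then d K else 0)"
      if K: "K \<in> \<T>" for K
    proof -
      have "divergence (\<lambda>x. P K x + d L *\<^sub>R Q K x) 0 = divergence (P K) 0 + d L * divergence (Q K) 0"
        by (simp only: divergence_add[OF P1(1)[OF K] P1_scaleR[OF P1(2)[OF K]]] divergence_scaleR[OF P1(2)[OF K]])
      then show ?thesis
        using P(2) Q(2) K insert.hyps(2) by (cases "K = L") simp_all
    qed
    moreover have "admissible \<Gamma>D \<Gamma>S \<Gamma>E (\<lambda>K x. P K x + d L *\<^sub>R Q K x)"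
      by (intro admissible_add admissible_scaleR P Q)
    ultimately show ?case by blast
  qed
  from this[OF finite_mesh order_refl] show ?thesis by simp
qed

section \<open>The elementwise divergence of a piecewise affine field\<close>

lemma broken_div_eq_piecewise:
  "broken_div \<T> v = piecewise (\<lambda>K. divergence (local_poly v K))"
  by (simp add: fun_eq_iff broken_div_def piecewise_def)

lemma broken_div_piecewise_constant:
  assumes v: "\<And>K. K \<in> \<T> \<Longrightarrow> \<exists>p. P1_on K v p"
  shows "broken_div \<T> v \<in> piecewise_constants \<Omega> \<T>"
proof -
  have P1: "P1 (local_poly v K)" if K: "K \<in> \<T>" for K
  proof -
    obtain p where p: "P1_on K v p" using v[OF K] by blast
    then show ?thesis using local_poly_unique[OF K p] by (simp add: P1_on_def)
  qed
  have const: "divergence (local_poly v K) = (\<lambda>x. divergence (local_poly v K) 0)" if "K \<in> \<T>" for K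
    by (rule ext) (rule divergence_P1_eq[OF P1[OF that]])
  have "continuous_on UNIV (divergence (local_poly v K))" if "K \<in> \<T>" for K
    by (subst const[OF that]) simp
  then have "L2_on \<Omega> (broken_div \<T> v)"
    unfolding broken_div_eq_piecewise by (rule L2_on_piecewise)
  moreover have "\<exists>c. AE x\<in>K in lebesgue. broken_div \<T> v x = c" if "K \<in> \<T>" for K
  proof (rule exI)
    show "AE x\<in>K in lebesgue. broken_div \<T> v x = divergence (local_poly v K) 0"
      using AE_piecewise[OF that, of "\<lambda>K. divergence (local_poly v K)"]
      unfolding broken_div_eq_piecewise
    proof eventually_elim
      case (elim x)
      then show ?case using divergence_P1_eq[OF P1[OF that], of x 0] by simp
    qed
  qed
  ultimately show ?thesis by (simp add: piecewise_constants_def)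
qed

lemma AE_domain_cells:
  assumes "\<And>K. K \<in> \<T> \<Longrightarrow> AE x\<in>K in lebesgue. Q x"
  shows "AE x\<in>\<Omega> in lebesgue. Q x"
proof -
  have "AE x in lebesgue. \<forall>K\<in>\<T>. x \<in> K \<longrightarrow> Q x"
    using finite_mesh assms by (intro AE_finite_allI) auto
  then show ?thesis
  proof eventually_elim
    case (elim x)
    show ?case
    proof
      assume "x \<in> \<Omega>"
      then obtain K where "K \<in> \<T>" "x \<in> K" using Union_mesh closure_subset[of \<Omega>] by blast
      with elim show "Q x" by blast
    qed
  qed
qed

end

lemma L2_class_cong:
  assumes "AE x\<in>\<Omega> in lebesgue. f x = h x"
  shows "L2_class \<Omega> f = L2_class \<Omega> h"
proof -
  have "(AE x\<in>\<Omega> in lebesgue. k x = f x) \<longleftrightarrow> (AE x\<in>\<Omega> in lebesgue. k x = h x)" for k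
  proof
    assume "AE x\<in>\<Omega> in lebesgue. k x = f x"
    with assms show "AE x\<in>\<Omega> in lebesgue. k x = h x" by eventually_elim simp
  next
    assume "AE x\<in>\<Omega> in lebesgue. k x = h x"
    with assms show "AE x\<in>\<Omega> in lebesgue. k x = f x" by eventually_elim simp
  qed
  then show ?thesis by (simp add: L2_class_def)
qed

theorem lemma3p2:
  fixes \<Omega> \<Gamma>D \<Gamma>N \<Gamma>S \<Gamma>E :: "(real^'n) set" and \<T> :: "(real^'n) set set"
  assumes "CARD('n) \<in> {2, 3}"
    and "polyhedral_lipschitz_domain \<Omega>"
    and "simplicial_mesh \<Omega> \<T>"
    and "boundary_partition \<Omega> \<Gamma>D \<Gamma>N \<Gamma>S \<Gamma>E"
    and "boundary_area \<Omega> \<T> \<Gamma>D > 0"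
    and "resolves_partition \<Omega> \<T> \<Gamma>D \<Gamma>N \<Gamma>S \<Gamma>E"
    and "\<exists>F\<in>boundary_faces \<Omega> \<T>. face_in F (\<Gamma>N \<union> \<Gamma>E)"
  shows "L2_class \<Omega> ` broken_div \<T> ` CR_space \<Omega> \<T> \<Gamma>D \<Gamma>S \<Gamma>E
       = L2_class \<Omega> ` piecewise_constants \<Omega> \<T>"
proof -
  interpret simplicial_domain \<Omega> \<T>
    using assms(2,3) by unfold_locales
  obtain F where F: "F \<in> boundary_faces \<Omega> \<T>" "face_in F (\<Gamma>N \<union> \<Gamma>E)"
    using assms(7) by blast
  obtain K where "F facet_of K" using F(1) by (auto simp: boundary_faces_def)
  \<comment> \<open>Disjointness of the parts excludes \<open>\<Gamma>D\<close> and
    \<open>\<Gamma>S\<close> only if the relative interior of \<open>F\<close> is inhabited, so a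
    point is exhibited.\<close>
  then obtain x where x: "x \<in> rel_interior F"
    using rel_interior_facet_nonempty by blast
  have "\<Gamma>D \<inter> \<Gamma>N = {}" "\<Gamma>D \<inter> \<Gamma>E = {}" "\<Gamma>N \<inter> \<Gamma>S = {}" "\<Gamma>S \<inter> \<Gamma>E = {}"
    using assms(4) by (simp_all add: boundary_partition_def)
  moreover have "x \<in> \<Gamma>N \<union> \<Gamma>E" using F(2) x by (auto simp: face_in_def)
  ultimately have "x \<notin> \<Gamma>D" "x \<notin> \<Gamma>S" by blast+
  then have nDS: "\<not> face_in F \<Gamma>D" "\<not> face_in F \<Gamma>S"
    using x by (auto simp: face_in_def)
  show ?thesis
  proof (intro equalityI subsetI)
    fix X assume "X \<in> L2_class \<Omega> ` broken_div \<T> ` CR_space \<Omega> \<T> \<Gamma>D \<Gamma>S \<Gamma>E"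
    then obtain v where v: "v \<in> CR_space \<Omega> \<T> \<Gamma>D \<Gamma>S \<Gamma>E" "X = L2_class \<Omega> (broken_div \<T> v)"
      by blast
    have "broken_div \<T> v \<in> piecewise_constants \<Omega> \<T>"
      using v(1) by (intro broken_div_piecewise_constant) (simp add: CR_space_def)
    then show "X \<in> L2_class \<Omega> ` piecewise_constants \<Omega> \<T>"
      using v(2) by blast
  next
    fix X assume "X \<in> L2_class \<Omega> ` piecewise_constants \<Omega> \<T>"
    then obtain q where q: "q \<in> piecewise_constants \<Omega> \<T>" "X = L2_class \<Omega> q"
      by blast
    then have "\<forall>K\<in>\<T>. \<exists>c. AE x\<in>K in lebesgue. q x = c"
      by (simp add: piecewise_constants_def)
    from bchoice[OF this] obtain d where d: "\<And>K. K \<in> \<T> \<Longrightarrow> AE x\<in>K in lebesgue. q x = d K"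
      by blast
    obtain P where P: "admissible \<Gamma>D \<Gamma>S \<Gamma>E P" "\<forall>K\<in>\<T>. divergence (P K) 0 = d K"
      using admissible_divergence_surj[OF F(1) nDS, of \<Gamma>E d] by blast
    \<comment> \<open>The representative \<open>q\<close> is constant on a cell only up to a null
      set, and \<open>broken_div\<close> is zero on the skeleton; the functions agree almost
      everywhere, which is all that \<open>L2_class\<close> sees.\<close>
    have "AE x\<in>\<Omega> in lebesgue. broken_div \<T> (piecewise P) x = q x"
    proof (rule AE_domain_cells)
      fix K assume K: "K \<in> \<T>"
      have P1: "P1 (P K)" by (rule admissibleD(1)[OF P(1) K])
      have "divergence (local_poly (piecewise P) K) x = d K" for x
        using local_poly_piecewise[of K P, OF K P1] divergence_P1_eq[OF P1, of x 0] P(2) K by simp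
      then have "AE x\<in>K in lebesgue. broken_div \<T> (piecewise P) x = d K"
        using AE_piecewise[OF K, of "\<lambda>K. divergence (local_poly (piecewise P) K)"]
        unfolding broken_div_eq_piecewise by simp
      with d[OF K] show "AE x\<in>K in lebesgue. broken_div \<T> (piecewise P) x = q x"
        by eventually_elim auto
    qed
    then have "X = L2_class \<Omega> (broken_div \<T> (piecewise P))"
      using L2_class_cong q(2) by metis
    then show "X \<in> L2_class \<Omega> ` broken_div \<T> ` CR_space \<Omega> \<T> \<Gamma>D \<Gamma>S \<Gamma>E"
      using admissible_imp_CR[OF P(1)] by blast
  qed
qed

end
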